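(* Let $I=(a,b)$ be a nonempty (possibly unbounded) open interval of $\mathbb{R}$, and let $\mathcal{E}$ be the set of all Lipschitz functions $f:I\to\mathbb{R}$ which are everywhere differentiable and Clarke exhaustive. Then $\mathcal{E}$ is spaceable for the semidistance $d_{\mathrm{Lip}}(f,g)=\|f-g\|_{\mathrm{Lip}}$; that is, $\mathcal{E}$ contains an infinite-dimensional linear subspace of $\mathrm{Lip}(I)$ which is closed in $\mathrm{Lip}(I)$ for the semidistance $d_{\mathrm{Lip}}$.
   Context: $\mathrm{Lip}(I)$ is the vector space of all Lipschitz functions $f:I\to\mathbb{R}$ and $\|f\|_{\mathrm{Lip}}=\sup_{x\neq y}\frac{|f(x)-f(y)|}{|x-y|}$ is a seminorm on it. A subset is called spaceable if it contains a closed infinite-dimensional linear subspace. For a locally Lipschitz $f:I\to\mathbb{R}$, with $\mathcal{D}_f$ its set of differentiability points, the Clarke subdifferential at $x\in I$ is $$\partial f(x)=\mathrm{conv}\Big\{\lim_{n\to\infty} f'(x_n)\,:\ x_n\to x,\ \{x_n\}\subset\mathcal{D}_f\setminus\mathcal{N},\ \text{the limit exists}\Big\},$$ where $\mathcal{N}$ is any Lebesgue-null set (the definition does not depend on $\mathcal{N}$). A Lipschitz function $f:I\to\mathbb{R}$ is called Clarke exhaustive if for every nonempty closed convex subset $K$ of $[-\|f\|_{\mathrm{Lip}},\|f\|_{\mathrm{Lip}}]$ there exists $x\in I$ with $\partial f(x)=K$. *)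

theory Defs
  imports "HOL-Analysis.Analysis" "HOL-Library.Function_Algebras"
begin

text \<open>
  Pointwise scalar multiplication makes \<open>'a \<Rightarrow> real\<close> a real vector space, so that the library's
  \<open>subspace\<close> and \<open>span\<close> apply to sets of functions. Addition is that of
  \<^theory>\<open>HOL-Library.Function_Algebras\<close>.
\<close>

instantiation "fun" :: (type, real_vector) real_vector
begin

definition scaleR_fun_def: "c *\<^sub>R f = (\<lambda>x. c *\<^sub>R f x)"

instance
  by standard (simp_all add: scaleR_fun_def fun_eq_iff scaleR_add_right scaleR_add_left)

end

lemma scaleR_fun_apply [simp]: "(c *\<^sub>R f) x = c *\<^sub>R f x"
  by (simp add: scaleR_fun_def)


text \<open>
  The library's metric topologies require \<open>d x y = 0 \<longrightarrow> x = y\<close>, which fails for a semidistance.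
\<close>

definition semidist_topology :: "'v set \<Rightarrow> ('v \<Rightarrow> 'v \<Rightarrow> real) \<Rightarrow> 'v topology" where
  "semidist_topology V d =
     topology (\<lambda>U. U \<subseteq> V \<and> (\<forall>f\<in>U. \<exists>r>0. \<forall>g\<in>V. d f g < r \<longrightarrow> g \<in> U))"

lemma openin_semidist_topology:
  "openin (semidist_topology V d) U \<longleftrightarrow>
     U \<subseteq> V \<and> (\<forall>f\<in>U. \<exists>r>0. \<forall>g\<in>V. d f g < r \<longrightarrow> g \<in> U)"
proof -
  let ?P = "\<lambda>U. U \<subseteq> V \<and> (\<forall>f\<in>U. \<exists>r>0. \<forall>g\<in>V. d f g < r \<longrightarrow> g \<in> U)"
  have int: "?P (S \<inter> T)" if S: "?P S" and T: "?P T" for S T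
  proof (intro conjI ballI)
    show "S \<inter> T \<subseteq> V" using S by blast
    fix f assume f: "f \<in> S \<inter> T"
    obtain r where r: "r > 0" "\<forall>g\<in>V. d f g < r \<longrightarrow> g \<in> S" using S f by blast
    obtain s where s: "s > 0" "\<forall>g\<in>V. d f g < s \<longrightarrow> g \<in> T" using T f by blast
    show "\<exists>t>0. \<forall>g\<in>V. d f g < t \<longrightarrow> g \<in> S \<inter> T"
      by (rule exI[of _ "min r s"]) (use r s in auto)
  qed
  have un: "?P (\<Union>\<U>)" if U: "\<forall>S\<in>\<U>. ?P S" for \<U>
  proof (intro conjI ballI)
    show "\<Union>\<U> \<subseteq> V" using U by blast
    fix f assume "f \<in> \<Union>\<U>"
    then obtain S where S: "S \<in> \<U>" "f \<in> S" by blast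
    then obtain r where "r > 0" "\<forall>g\<in>V. d f g < r \<longrightarrow> g \<in> S" using U by blast
    then show "\<exists>r>0. \<forall>g\<in>V. d f g < r \<longrightarrow> g \<in> \<Union>\<U>" using S by blast
  qed
  have "istopology ?P"
    unfolding istopology_def using int un by blast
  then show ?thesis
    by (simp add: semidist_topology_def)
qed

lemma topspace_semidist_topology [simp]: "topspace (semidist_topology V d) = V"
proof -
  have "openin (semidist_topology V d) V"
    unfolding openin_semidist_topology by (auto intro: exI[of _ 1])
  then show ?thesis
    by (metis openin_subset openin_topspace openin_semidist_topology subset_antisym)
qed

definition infinite_dimensional :: "'v::real_vector set \<Rightarrow> bool" where
  "infinite_dimensional W \<longleftrightarrow> \<not> (\<exists>B. finite B \<and> span B = W)"

definition spaceable :: "'v::real_vector set \<Rightarrow> ('v \<Rightarrow> 'v \<Rightarrow> real) \<Rightarrow> 'v set \<Rightarrow> bool" where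
  "spaceable V d A \<longleftrightarrow>
     (\<exists>W. W \<subseteq> A \<and> subspace W \<and> infinite_dimensional W \<and> closedin (semidist_topology V d) W)"


text \<open>
  A function \<open>I \<rightarrow> \<real>\<close> is represented by its extension by \<open>0\<close> to the whole line, which is compatible
  with the vector space operations. As \<open>I\<close> is open below, derivatives at points of \<open>I\<close> are
  unaffected by the extension.
\<close>

definition Lip :: "real set \<Rightarrow> (real \<Rightarrow> real) set" where
  "Lip I = {f. (\<forall>x. x \<notin> I \<longrightarrow> f x = 0) \<and> (\<exists>L. L-lipschitz_on I f)}"

definition Lip_norm :: "real set \<Rightarrow> (real \<Rightarrow> real) \<Rightarrow> real" where
  "Lip_norm I f = Sup {\<bar>f x - f y\<bar> / \<bar>x - y\<bar> | x y. x \<in> I \<and> y \<in> I \<and> x \<noteq> y}"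

definition Lip_dist :: "real set \<Rightarrow> (real \<Rightarrow> real) \<Rightarrow> (real \<Rightarrow> real) \<Rightarrow> real" where
  "Lip_dist I f g = Lip_norm I (f - g)"

definition diff_points :: "real set \<Rightarrow> (real \<Rightarrow> real) \<Rightarrow> real set" where
  "diff_points I f = {x \<in> I. f differentiable (at x)}"

text \<open>
  The Clarke subdifferential does not depend on the null set \<open>N\<close>; it is kept as a parameter here
  rather than fixed to a particular choice.
\<close>

definition clarke_subdiff :: "real set \<Rightarrow> real set \<Rightarrow> (real \<Rightarrow> real) \<Rightarrow> real \<Rightarrow> real set" where
  "clarke_subdiff N I f x = convex hull
     {l. \<exists>u :: nat \<Rightarrow> real. u \<longlonglongrightarrow> x \<and> range u \<subseteq> diff_points I f - N \<and>
           (\<lambda>n. deriv f (u n)) \<longlonglongrightarrow> l}"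

definition clarke_exhaustive :: "real set \<Rightarrow> real set \<Rightarrow> (real \<Rightarrow> real) \<Rightarrow> bool" where
  "clarke_exhaustive N I f \<longleftrightarrow>
     (\<forall>K. K \<noteq> {} \<and> closed K \<and> convex K \<and> K \<subseteq> {- Lip_norm I f .. Lip_norm I f} \<longrightarrow>
        (\<exists>x\<in>I. clarke_subdiff N I f x = K))"

definition diff_clarke_exhaustive :: "real set \<Rightarrow> real set \<Rightarrow> (real \<Rightarrow> real) set" where
  "diff_clarke_exhaustive N I =
     {f \<in> Lip I. (\<forall>x\<in>I. f differentiable (at x)) \<and> clarke_exhaustive N I f}"

end

(*
  One profile phi, differentiable with compact support and |phi'| <= 1, realises every interval
  [p,q] in [-1,1] as a Clarke subdifferential: its derivative is a continuous function m plus
  oscillations of amplitude r on tiny intervals in the gaps of the Cantor set, where (m, r) is built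
  from Schoenberg's space-filling curve. At the point of the Cantor set where (m, r) = (M, R) the
  cluster values of phi' fill [M - R, M + R], and phi remains differentiable there because a bump is
  quadratically small compared with its distance to the Cantor set.

  Put small copies f_n of phi on disjoint intervals shrinking fast to a point of I and let W consist
  of the functions C + sum c_n f_n with c_n -> 0. The seminorm of such a function is max |c_n|, it is
  attained at some m, and then c_m f_m alone realises every admissible interval. The map c -> sum c_n f_n
  is bounded, as are the coordinate functionals, so W is a closed copy of c_0 plus the constants.
*)
theory Submission
  imports Defs
begin

section \<open>Cluster values of a derivative\<close>

lemma convex_hull_between:
  fixes p q :: real
  assumes "p \<in> S" "q \<in> S" "S \<subseteq> {p..q}"
  shows "convex hull S = {p..q}"
proof
  show "convex hull S \<subseteq> {p..q}"
    using assms(3) by (intro hull_minimal) auto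
  have "p \<le> q" using assms by auto
  have "{p..q} = closed_segment p q"
    using \<open>p \<le> q\<close> by (simp add: closed_segment_eq_real_ivl)
  also have "\<dots> \<subseteq> convex hull S"
    using assms by (intro closed_segment_subset) (auto simp: hull_inc)
  finally show "{p..q} \<subseteq> convex hull S" .
qed

text \<open>The second clause asks for whole open sets of good points rather than single ones, so that
  deleting a null set changes nothing.\<close>

definition cluster_range :: "(real \<Rightarrow> real) \<Rightarrow> real \<Rightarrow> real \<Rightarrow> real \<Rightarrow> bool" where
  "cluster_range g x p q \<longleftrightarrow>
     (\<forall>e>0. \<forall>\<^sub>F y in nhds x. p - e \<le> g y \<and> g y \<le> q + e) \<and>
     (\<forall>v\<in>{p, q}. \<forall>e>0. \<forall>V. open V \<and> x \<in> V \<longrightarrow>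
        (\<exists>U. open U \<and> U \<noteq> {} \<and> U \<subseteq> V \<and> (\<forall>y\<in>U. \<bar>g y - v\<bar> < e)))"

lemma cluster_range_le:
  assumes "cluster_range g x p q"
  shows "p \<le> q"
proof (rule ccontr)
  assume "\<not> p \<le> q"
  then have e: "(p - q) / 4 > 0" by simp
  have "\<forall>\<^sub>F y in nhds x. p - (p - q) / 4 \<le> g y \<and> g y \<le> q + (p - q) / 4"
    using assms e by (auto simp: cluster_range_def)
  then have "p - (p - q) / 4 \<le> g x \<and> g x \<le> q + (p - q) / 4"
    by (rule eventually_nhds_x_imp_x)
  then show False using e by (simp add: field_simps)
qed

text \<open>The first clause of \<open>cluster_range\<close> keeps all limits of derivatives in
  [p, q]. Both endpoints occur as limits along points outside \<open>N\<close>, because a nonempty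
  open set is never contained in a null set; the convex hull then fills in the rest.\<close>

lemma clarke_subdiff_eq_cluster_range:
  assumes I: "open I" "x \<in> I" and f: "\<And>y. y \<in> I \<Longrightarrow> (f has_real_derivative g y) (at y)"
    and N: "N \<in> null_sets lebesgue" and g: "cluster_range g x p q"
  shows "clarke_subdiff N I f x = {p..q}"
proof -
  let ?S = "{l. \<exists>u :: nat \<Rightarrow> real. u \<longlonglongrightarrow> x \<and> range u \<subseteq> diff_points I f - N \<and>
           (\<lambda>n. deriv f (u n)) \<longlonglongrightarrow> l}"
  have dp: "diff_points I f = I"
    using f by (auto simp: diff_points_def real_differentiable_def)
  have dg: "deriv f y = g y" if "y \<in> I" for y
    using f[OF that] by (rule DERIV_imp_deriv)
  have mem: "v \<in> ?S" if v: "v \<in> {p, q}" for v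
  proof -
    have "\<exists>y. y \<in> I - N \<and> \<bar>y - x\<bar> < 1 / Suc n \<and> \<bar>g y - v\<bar> < 1 / Suc n" for n
    proof -
      have "1 / real (Suc n) > 0 \<and> open (I \<inter> ball x (1 / Suc n)) \<and> x \<in> I \<inter> ball x (1 / Suc n)"
        using I by auto
      then obtain U where U: "open U" "U \<noteq> {}" "U \<subseteq> I \<inter> ball x (1 / Suc n)"
        "\<forall>y\<in>U. \<bar>g y - v\<bar> < 1 / Suc n"
        using g v unfolding cluster_range_def by meson
      have "\<not> negligible U"
        using U by (intro open_not_negligible) auto
      then have "\<not> U \<subseteq> N"
        using N negligible_subset by (auto simp: negligible_iff_null_sets)
      then obtain y where "y \<in> U" "y \<notin> N" by auto
      then show ?thesis
        using U by (auto simp: dist_real_def abs_minus_commute intro!: exI[of _ y])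
    qed
    then obtain u where u: "\<And>n. u n \<in> I - N" "\<And>n. \<bar>u n - x\<bar> < 1 / Suc n"
      "\<And>n. \<bar>g (u n) - v\<bar> < 1 / Suc n"
      by metis
    have z: "(\<lambda>n. 1 / real (Suc n)) \<longlonglongrightarrow> 0"
      by (rule LIMSEQ_Suc[OF lim_1_over_n])
    have "u \<longlonglongrightarrow> x"
      by (rule LIM_zero_cancel, rule Lim_null_comparison[OF _ z])
        (use u(2) in \<open>auto intro!: always_eventually less_imp_le\<close>)
    moreover have "(\<lambda>n. deriv f (u n)) \<longlonglongrightarrow> v"
      by (rule LIM_zero_cancel, rule Lim_null_comparison[OF _ z])
        (use u dg in \<open>auto intro!: always_eventually less_imp_le\<close>)
    ultimately show ?thesis using u(1) dp by blast
  qed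
  moreover have "l \<in> {p..q}" if l: "l \<in> ?S" for l
  proof -
    obtain u where u: "u \<longlonglongrightarrow> x" "range u \<subseteq> I - N" "(\<lambda>n. deriv f (u n)) \<longlonglongrightarrow> l"
      using l dp by auto
    have lim: "(\<lambda>n. g (u n)) \<longlonglongrightarrow> l"
      using u(2,3) by (simp add: dg image_subset_iff)
    have ev: "\<forall>\<^sub>F n in sequentially. p - e \<le> g (u n) \<and> g (u n) \<le> q + e" if "e > 0" for e
    proof -
      have "\<forall>\<^sub>F y in nhds x. p - e \<le> g y \<and> g y \<le> q + e"
        using g that by (auto simp: cluster_range_def)
      then show ?thesis using u(1) by (auto simp: filterlim_iff)
    qed
    have "p - e \<le> l \<and> l \<le> q + e" if "e > 0" for e
      using ev[OF that] tendsto_lowerbound[OF lim, of "p - e"] tendsto_upperbound[OF lim, of "q + e"]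
      by (simp add: eventually_conj_iff)
    then show ?thesis
      by (metis atLeastAtMost_iff field_le_epsilon le_diff_eq diff_le_eq)
  qed
  ultimately show ?thesis
    unfolding clarke_subdiff_def by (intro convex_hull_between subsetI) blast+
qed

text \<open>Locality of the notion. It allows the derivative of a patched function to be replaced by
  that of the single piece living near the point.\<close>

lemma cluster_range_cong:
  assumes g: "cluster_range g x p q" and V: "open V" "x \<in> V" "\<And>y. y \<in> V \<Longrightarrow> h y = g y"
  shows "cluster_range h x p q"
  unfolding cluster_range_def
proof (intro conjI allI impI ballI)
  fix e :: real assume "e > 0"
  then have "\<forall>\<^sub>F y in nhds x. p - e \<le> g y \<and> g y \<le> q + e"
    using g by (auto simp: cluster_range_def)
  moreover have "\<forall>\<^sub>F y in nhds x. y \<in> V" using V eventually_nhds by blast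
  ultimately show "\<forall>\<^sub>F y in nhds x. p - e \<le> h y \<and> h y \<le> q + e"
    by eventually_elim (simp add: V)
next
  fix v e :: real and V' assume v: "v \<in> {p, q}" "e > 0" "open V' \<and> x \<in> V'"
  then have "open (V \<inter> V') \<and> x \<in> V \<inter> V'" using V by auto
  then obtain U where "open U" "U \<noteq> {}" "U \<subseteq> V \<inter> V'" "\<forall>y\<in>U. \<bar>g y - v\<bar> < e"
    using g v unfolding cluster_range_def by meson
  then show "\<exists>U. open U \<and> U \<noteq> {} \<and> U \<subseteq> V' \<and> (\<forall>y\<in>U. \<bar>h y - v\<bar> < e)"
    using V(3) by (intro exI[of _ U]) auto
qed

lemma cluster_range_affine:
  assumes g: "cluster_range g x p q" and w: "w > 0"
  shows "cluster_range (\<lambda>y. g ((y - t) / w)) (t + w * x) p q"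
proof -
  let ?h = "\<lambda>y. (y - t) / w"
  have c: "isCont ?h y" for y by (intro continuous_intros) (use w in auto)
  have hx: "?h (t + w * x) = x" using w by simp
  show ?thesis
    unfolding cluster_range_def
  proof (intro conjI allI impI ballI)
    fix e :: real assume "e > 0"
    then have "\<forall>\<^sub>F y in nhds x. p - e \<le> g y \<and> g y \<le> q + e"
      using g by (auto simp: cluster_range_def)
    moreover have "filterlim ?h (nhds (?h (t + w * x))) (nhds (t + w * x))"
      by (rule tendsto_at_iff_tendsto_nhds[THEN iffD1]) (use c in \<open>simp only: isCont_def\<close>)
    ultimately show "\<forall>\<^sub>F y in nhds (t + w * x). p - e \<le> g (?h y) \<and> g (?h y) \<le> q + e"
      using eventually_compose_filterlim[of "\<lambda>y. p - e \<le> g y \<and> g y \<le> q + e" "nhds x" ?h]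
      unfolding hx by blast
  next
    fix v e :: real and V assume v: "v \<in> {p, q}" "e > 0" "open V \<and> t + w * x \<in> V"
    let ?k = "\<lambda>y. t + w * y"
    have "open (?k -` V)" using v by (intro open_vimage) (auto intro!: continuous_intros)
    then have "open (?k -` V) \<and> x \<in> ?k -` V" using v by auto
    then obtain U where U: "open U" "U \<noteq> {}" "U \<subseteq> ?k -` V" "\<forall>y\<in>U. \<bar>g y - v\<bar> < e"
      using g v unfolding cluster_range_def by meson
    have kh: "?k (?h y) = y" for y using w by simp
    have hk: "?h (?k y) = y" for y using w by simp
    show "\<exists>U. open U \<and> U \<noteq> {} \<and> U \<subseteq> V \<and> (\<forall>y\<in>U. \<bar>g (?h y) - v\<bar> < e)"
    proof (intro exI conjI)
      show "open (?h -` U)"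
        using U(1) c by (intro open_vimage) (auto intro!: continuous_at_imp_continuous_on)
      show "?h -` U \<noteq> {}" using U(2) hk by (metis vimageI empty_iff ex_in_conv)
      show "?h -` U \<subseteq> V"
      proof
        fix y assume "y \<in> ?h -` U"
        then have "?k (?h y) \<in> V" using U(3) by blast
        then show "y \<in> V" unfolding kh .
      qed
    qed (use U in auto)
  qed
qed

text \<open>A negative factor swaps the two endpoints, hence \<open>min\<close> and
  \<open>max\<close>; coefficients of either sign, and 0, are then treated uniformly.\<close>

lemma cluster_range_scale:
  assumes g: "cluster_range g x p q"
  shows "cluster_range (\<lambda>y. c * g y) x (min (c * p) (c * q)) (max (c * p) (c * q))"
  unfolding cluster_range_def
proof (intro conjI allI impI ballI)
  fix e :: real assume e: "e > 0"
  \<comment> \<open>The added 1 keeps the denominator positive when \<open>c = 0\<close>.\<close>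
  define e' where "e' = e / (\<bar>c\<bar> + 1)"
  have e': "e' > 0" "\<bar>c\<bar> * e' \<le> e" using e by (auto simp: e'_def field_simps)
  have "\<forall>\<^sub>F y in nhds x. p - e' \<le> g y \<and> g y \<le> q + e'"
    using g e' by (auto simp: cluster_range_def)
  then show "\<forall>\<^sub>F y in nhds x. min (c * p) (c * q) - e \<le> c * g y \<and> c * g y \<le> max (c * p) (c * q) + e"
  proof eventually_elim
    case (elim y)
    show ?case
    proof (cases "c \<ge> 0")
      case True
      then have "c * (p - e') \<le> c * g y" "c * g y \<le> c * (q + e')"
        using elim by (auto intro!: mult_left_mono)
      then show ?thesis using e'(2) True unfolding min_def max_def by (simp add: algebra_simps)
    next
      case False
      then have "c * (p - e') \<ge> c * g y" "c * g y \<ge> c * (q + e')"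
        using elim by (auto intro!: mult_left_mono_neg)
      moreover have "c * q \<le> c * p"
        using False cluster_range_le[OF g] by (simp add: mult_left_mono_neg)
      ultimately show ?thesis using e'(2) False by (simp add: algebra_simps min.absorb2 max.absorb1)
    qed
  qed
next
  fix v e :: real and V
  assume v: "v \<in> {min (c * p) (c * q), max (c * p) (c * q)}" and e: "e > 0" and V: "open V \<and> x \<in> V"
  define e' where "e' = e / (\<bar>c\<bar> + 1)"
  have e': "e' > 0" "\<bar>c\<bar> * e' < e" using e by (auto simp: e'_def field_simps)
  obtain v' where v': "v' \<in> {p, q}" "v = c * v'" using v by (auto simp: min_def max_def split: if_splits)
  obtain U where U: "open U" "U \<noteq> {}" "U \<subseteq> V" "\<forall>y\<in>U. \<bar>g y - v'\<bar> < e'"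
    using g v' V e' unfolding cluster_range_def by meson
  have "\<bar>c * g y - v\<bar> < e" if "y \<in> U" for y
  proof -
    have "\<bar>c * g y - v\<bar> = \<bar>c\<bar> * \<bar>g y - v'\<bar>"
      by (simp add: v' abs_mult flip: right_diff_distrib)
    also have "\<dots> \<le> \<bar>c\<bar> * e'" using U(4) that by (intro mult_left_mono) auto
    finally show ?thesis using e' by simp
  qed
  then show "\<exists>U. open U \<and> U \<noteq> {} \<and> U \<subseteq> V \<and> (\<forall>y\<in>U. \<bar>c * g y - v\<bar> < e)"
    using U by auto
qed

section \<open>Patching small functions on disjoint balls\<close>

definition patch :: "('i \<Rightarrow> real) \<Rightarrow> ('i \<Rightarrow> real) \<Rightarrow> ('i \<Rightarrow> real \<Rightarrow> real) \<Rightarrow> real \<Rightarrow> real" where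
  "patch t d b z = (\<Sum>s | \<bar>z - t s\<bar> < d s. b s z)"

text \<open>In all uses the balls are disjoint, so that the sum has at most one term (if there were
  infinitely many, it would be the junk value \<open>0\<close>).\<close>

definition disjoint_balls :: "('i \<Rightarrow> real) \<Rightarrow> ('i \<Rightarrow> real) \<Rightarrow> bool" where
  "disjoint_balls t d \<longleftrightarrow> (\<forall>s s' z. \<bar>z - t s\<bar> < d s \<longrightarrow> \<bar>z - t s'\<bar> < d s' \<longrightarrow> s = s')"

lemma patch_in:
  assumes "disjoint_balls t d" "\<bar>z - t s\<bar> < d s"
  shows "patch t d b z = b s z"
proof -
  have "{s. \<bar>z - t s\<bar> < d s} = {s}"
    using assms unfolding disjoint_balls_def by blast
  then show ?thesis by (simp add: patch_def)
qed

lemma patch_out: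
  assumes "\<And>s. \<bar>z - t s\<bar> \<ge> d s"
  shows "patch t d b z = 0"
proof -
  have "{s. \<bar>z - t s\<bar> < d s} = {}" using assms by (simp add: not_less)
  then show ?thesis by (simp add: patch_def)
qed

lemma patch_bound:
  assumes "disjoint_balls t d" "L \<ge> 0" "\<And>s. \<bar>z - t s\<bar> < d s \<Longrightarrow> \<bar>b s z\<bar> \<le> L"
  shows "\<bar>patch t d b z\<bar> \<le> L"
proof (cases "\<exists>s. \<bar>z - t s\<bar> < d s")
  case True
  then show ?thesis using assms patch_in by metis
next
  case False
  then show ?thesis using patch_out[of d z t b] assms(2) by (simp add: not_less)
qed

lemma DERIV_zero_of_quadratic_bound:
  fixes f :: "real \<Rightarrow> real"
  assumes "f y = 0" "\<And>z. \<bar>f z\<bar> \<le> K * \<bar>z - y\<bar>^2"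
  shows "(f has_real_derivative 0) (at y)"
proof -
  have "((\<lambda>z. K * \<bar>z - y\<bar>) \<longlongrightarrow> K * \<bar>y - y\<bar>) (at y)"
    by (intro tendsto_intros)
  then have lim: "((\<lambda>z. K * \<bar>z - y\<bar>) \<longlongrightarrow> 0) (at y)" by simp
  have "((\<lambda>z. (f z - f y) / (z - y)) \<longlongrightarrow> 0) (at y)"
  proof (rule Lim_null_comparison[OF _ lim])
    show "\<forall>\<^sub>F z in at y. norm ((f z - f y) / (z - y)) \<le> K * \<bar>z - y\<bar>"
      unfolding eventually_at_filter
      using assms by (auto intro!: always_eventually simp: divide_simps power2_eq_square mult.assoc)
  qed
  then show ?thesis by (simp add: has_field_derivative_iff)
qed

text \<open>At a point \<open>y\<close> outside all balls, a piece that is nonzero at \<open>z\<close> belongs to a ball of radius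
  at most \<open>2 * \<bar>z - y\<bar>\<close>, hence is of size \<open>O((z - y)\<^sup>2)\<close>. No hypothesis on how the balls accumulate is
  needed.\<close>

lemma DERIV_patch:
  assumes dj: "disjoint_balls t d"
    and supp: "\<And>s z. d s / 2 < \<bar>z - t s\<bar> \<Longrightarrow> b s z = 0"
    and small: "\<And>s z. \<bar>b s z\<bar> \<le> K * (d s)^2"
    and der: "\<And>s z. (b s has_real_derivative b' s z) (at z)"
  shows "(patch t d b has_real_derivative patch t d b' y) (at y)"
proof (cases "\<exists>s. \<bar>y - t s\<bar> < d s")
  case True
  then obtain s where s: "\<bar>y - t s\<bar> < d s" by blast
  have "(patch t d b has_real_derivative b' s y) (at y)"
  proof (rule has_field_derivative_transform_within_open[OF der])
    show "open (ball (t s) (d s))" "y \<in> ball (t s) (d s)"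
      using s by (auto simp: dist_real_def)
    show "b s z = patch t d b z" if "z \<in> ball (t s) (d s)" for z
      using that patch_in[OF dj, of z s b] by (simp add: dist_real_def abs_minus_commute)
  qed
  then show ?thesis using patch_in[OF dj s] by metis
next
  case False
  then have y: "\<bar>y - t s\<bar> \<ge> d s" for s by (simp add: not_less)
  \<comment> \<open>The 4 is the square of the 2 in \<open>d s \<le> 2 * \<bar>z - y\<bar>\<close>;
    the absolute value makes the bound nonnegative, as \<open>patch_bound\<close> requires.\<close>
  have K: "\<bar>patch t d b z\<bar> \<le> 4 * \<bar>K\<bar> * \<bar>z - y\<bar>^2" for z
  proof (rule patch_bound[OF dj])
    fix s assume s: "\<bar>z - t s\<bar> < d s"
    show "\<bar>b s z\<bar> \<le> 4 * \<bar>K\<bar> * \<bar>z - y\<bar>^2"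
    proof (cases "d s / 2 < \<bar>z - t s\<bar>")
      case False
      then have "d s / 2 \<le> \<bar>z - y\<bar>" using y[of s] by linarith
      then have "(d s / 2)^2 \<le> \<bar>z - y\<bar>^2" using s by (intro power_mono) auto
      then have "\<bar>K\<bar> * (d s)^2 \<le> \<bar>K\<bar> * (4 * \<bar>z - y\<bar>^2)"
        by (intro mult_left_mono) (auto simp: power_divide)
      moreover have "K * (d s)^2 \<le> \<bar>K\<bar> * (d s)^2" by (intro mult_right_mono) auto
      ultimately show ?thesis using small[of s z] by linarith
    qed (simp add: supp)
  qed auto
  have "patch t d b y = 0" "patch t d b' y = 0" using y by (auto intro!: patch_out)
  then show ?thesis using DERIV_zero_of_quadratic_bound[OF _ K] by simp
qed

section \<open>The Cantor set and the Schoenberg curve\<close>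

text \<open>With \<open>fl n\<close> the floor of \<open>2 ^ n * u\<close>, the digits
  \<open>fl (Suc n) - 2 * fl n\<close> have partial sums \<open>fl n / 2 ^ n\<close>, which converge
  to \<open>u\<close>. This starts from \<open>fl 0 = 0\<close>, so \<open>u = 1\<close> is treated
  separately, with all digits 1.\<close>

lemma binary_expansion_exists:
  fixes u :: real
  assumes "0 \<le> u" "u \<le> 1"
  obtains a :: "nat \<Rightarrow> bool" where "(\<lambda>k. of_bool (a k) * (1/2) ^ Suc k) sums u"
proof (cases "u = 1")
  case True
  show ?thesis using that[of "\<lambda>_. True"] power_half_series True by simp
next
  case False
  define fl :: "nat \<Rightarrow> int" where "fl n = \<lfloor>2 ^ n * u\<rfloor>" for n
  define a where "a k \<longleftrightarrow> fl (Suc k) = 2 * fl k + 1" for k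
  have a: "fl (Suc k) = 2 * fl k + of_bool (a k)" for k
  proof -
    have "2 * fl k \<le> fl (Suc k)" "fl (Suc k) < 2 * fl k + 2"
      unfolding fl_def by (simp_all add: le_floor_iff floor_less_iff) linarith+
    then show ?thesis by (auto simp: a_def)
  qed
  have part: "(\<Sum>k<n. of_bool (a k) * (1/2) ^ Suc k) = fl n / 2 ^ n" for n
  proof (induction n)
    case 0
    have "\<lfloor>u\<rfloor> = 0" using assms False by (simp add: floor_eq_iff)
    then show ?case by (simp add: fl_def)
  next
    case (Suc n)
    then show ?case by (simp add: a field_simps)
  qed
  have "(\<lambda>n. fl n / 2 ^ n) \<longlonglongrightarrow> u"
  proof (rule LIM_zero_cancel, rule Lim_null_comparison)
    show "(\<lambda>n. (1/2::real) ^ n) \<longlonglongrightarrow> 0" by (rule LIMSEQ_power_zero) simp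
    have "\<bar>fl n / 2 ^ n - u\<bar> \<le> (1/2) ^ n" for n
    proof -
      have "\<bar>fl n - 2 ^ n * u\<bar> \<le> 1" unfolding fl_def by linarith
      then have "\<bar>fl n - 2 ^ n * u\<bar> / 2 ^ n \<le> 1 / 2 ^ n" by (intro divide_right_mono) auto
      moreover have "\<bar>fl n / 2 ^ n - u\<bar> = \<bar>fl n - 2 ^ n * u\<bar> / 2 ^ n"
        by (subst abs_div_pos) (simp_all add: diff_divide_distrib)
      ultimately show ?thesis by (simp add: power_one_over)
    qed
    then show "\<forall>\<^sub>F n in sequentially. norm (fl n / 2 ^ n - u) \<le> (1/2) ^ n" by simp
  qed
  then have "(\<lambda>k. of_bool (a k) * (1/2) ^ Suc k) sums u"
    unfolding sums_def by (simp only: part)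
  then show ?thesis by (rule that)
qed

text \<open>The usual parametrisation of the Cantor set by ternary expansions with digits 0 and
  2.\<close>

definition cantor_point :: "(nat \<Rightarrow> bool) \<Rightarrow> real" where
  "cantor_point a = (\<Sum>k. 2 * of_bool (a k) * (1/3) ^ Suc k)"

text \<open>The midpoints of the open middle thirds removed in the construction of the Cantor set; the list
  is the address of the interval whose middle third is removed.\<close>

fun gap_mid :: "bool list \<Rightarrow> real" where
  "gap_mid [] = 1 / 2"
| "gap_mid (c # s) = (2 * of_bool c + gap_mid s) / 3"

lemma summable_cantor: "summable (\<lambda>k. 2 * of_bool (a k) * (1/3::real) ^ Suc k)"
proof (rule summable_comparison_test')
  show "summable (\<lambda>k. 2 * (1/3::real) ^ Suc k)"
    by (intro summable_mult) (simp add: summable_Suc_iff summable_geometric del: power_Suc)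
qed simp

text \<open>Self-similarity of the Cantor set. It has the same shape as the recursion of
  \<open>gap_mid\<close>, so that the distance estimates below can peel off one digit at a
  time.\<close>

lemma cantor_point_rec: "cantor_point a = (2 * of_bool (a 0) + cantor_point (a \<circ> Suc)) / 3"
proof -
  have "cantor_point a = 2 * of_bool (a 0) / 3 + (\<Sum>k. 2 * of_bool (a (Suc k)) * (1/3) ^ Suc (Suc k))"
    unfolding cantor_point_def using suminf_split_head[OF summable_cantor[of a]] by simp
  also have "(\<Sum>k. 2 * of_bool (a (Suc k)) * (1/3::real) ^ Suc (Suc k)) = cantor_point (a \<circ> Suc) / 3"
    unfolding cantor_point_def
    using suminf_divide[OF summable_cantor[of "a \<circ> Suc"], of 3] by (simp add: mult_ac)
  finally show ?thesis by (simp add: add_divide_distrib)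
qed

lemma cantor_point_bounds: "0 \<le> cantor_point a" "cantor_point a \<le> 1"
proof -
  show "0 \<le> cantor_point a"
    unfolding cantor_point_def by (intro suminf_nonneg summable_cantor) simp
  have s: "(\<lambda>k. 2 * (1/3::real) ^ Suc k) sums 1"
    using sums_mult[OF geometric_sums[of "1/3::real"], of "2/3"] by (simp add: mult_ac)
  have "cantor_point a \<le> (\<Sum>k. 2 * (1/3::real) ^ Suc k)"
    unfolding cantor_point_def
    using s by (intro suminf_le summable_cantor) (auto simp: sums_iff)
  then show "cantor_point a \<le> 1" using s by (simp add: sums_iff)
qed

lemma gap_mid_bounds: "0 < gap_mid s" "gap_mid s < 1"
  by (induction s) auto

lemma power_third_Suc: "(1/3::real) ^ Suc n = (1/3) ^ n / 3"
  by simp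

text \<open>The gap with address \<open>s\<close> has length \<open>(1/3) ^ Suc (length s)\<close>
  and its midpoint is half of that away from the Cantor set. In the induction, equal first digits
  scale the distance by 1/3, while different ones put the two points into opposite outer
  thirds.\<close>

lemma dist_cantor_point_gap_mid: "(1/3) ^ length s / 6 \<le> \<bar>cantor_point a - gap_mid s\<bar>"
proof (induction s arbitrary: a)
  case Nil
  then show ?case
    using cantor_point_rec[of a] cantor_point_bounds[of "a \<circ> Suc"] by (cases "a 0") auto
next
  case (Cons c s)
  have p: "(1/3::real) ^ length s \<le> 1" by (simp add: power_le_one)
  show ?case
  proof (cases "a 0 = c")
    case True
    then have "cantor_point a - gap_mid (c # s) = (cantor_point (a \<circ> Suc) - gap_mid s) / 3"
      by (subst cantor_point_rec) (simp add: field_simps)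
    then have "\<bar>cantor_point a - gap_mid (c # s)\<bar> = \<bar>cantor_point (a \<circ> Suc) - gap_mid s\<bar> / 3"
      by (simp only: abs_divide abs_numeral)
    moreover have "(1/3) ^ length s / 6 / 3 \<le> \<bar>cantor_point (a \<circ> Suc) - gap_mid s\<bar> / 3"
      by (intro divide_right_mono Cons.IH) simp
    ultimately show ?thesis by (simp only: length_Cons power_third_Suc divide_divide_eq_left mult.commute)
  next
    case False
    then have "1 / 3 \<le> \<bar>cantor_point a - gap_mid (c # s)\<bar>"
      using cantor_point_bounds[of "a \<circ> Suc"] gap_mid_bounds[of s]
      by (subst cantor_point_rec) (cases c; simp add: field_simps)
    then show ?thesis using p by simp
  qed
qed

text \<open>The midpoint with the longer address lies outside the gap of the shorter one, so half
  the length of the latter gap separates them.\<close>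

lemma dist_gap_mid:
  assumes "s \<noteq> s'"
  shows "(1/3) ^ min (length s) (length s') / 6 \<le> \<bar>gap_mid s - gap_mid s'\<bar>"
  using assms
proof (induction s arbitrary: s')
  case Nil
  then obtain c r where "s' = c # r" by (cases s') auto
  then show ?case using gap_mid_bounds[of r] by (cases c) auto
next
  case (Cons c s)
  show ?case
  proof (cases s')
    case Nil
    then show ?thesis using gap_mid_bounds[of s] by (cases c) auto
  next
    case (Cons c' r)
    have p: "(1/3::real) ^ min (length s) (length r) \<le> 1" by (simp add: power_le_one)
    show ?thesis
    proof (cases "c = c'")
      case True
      then have "gap_mid (c # s) - gap_mid s' = (gap_mid s - gap_mid r) / 3"
        using Cons by (simp add: field_simps)
      then have "\<bar>gap_mid (c # s) - gap_mid s'\<bar> = \<bar>gap_mid s - gap_mid r\<bar> / 3"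
        by (simp only: abs_divide abs_numeral)
      moreover have "s \<noteq> r" using Cons True Cons.prems by simp
      then have "(1/3) ^ min (length s) (length r) / 6 / 3 \<le> \<bar>gap_mid s - gap_mid r\<bar> / 3"
        by (intro divide_right_mono Cons.IH) simp_all
      ultimately show ?thesis
        by (simp only: Cons length_Cons min_Suc_Suc power_third_Suc divide_divide_eq_left mult.commute)
    next
      case False
      then have "1 / 3 \<le> \<bar>gap_mid (c # s) - gap_mid s'\<bar>"
        using gap_mid_bounds[of s] gap_mid_bounds[of r] Cons
        by (cases c; simp add: field_simps)
      then show ?thesis using p Cons by simp
    qed
  qed
qed

text \<open>Both points lie in the interval of length \<open>(1/3) ^ n\<close> selected by the first
  \<open>n\<close> digits. Hence gaps accumulate at every point of the Cantor set.\<close>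

lemma gap_mid_prefix: "\<bar>cantor_point a - gap_mid (map a [0..<n])\<bar> \<le> (1/3) ^ n"
proof (induction n arbitrary: a)
  case 0
  then show ?case using cantor_point_bounds[of a] by auto
next
  case (Suc n)
  have "map a [0..<Suc n] = a 0 # map (a \<circ> Suc) [0..<n]"
    by (simp add: upt_conv_Cons map_Suc_upt[symmetric] del: upt_Suc)
  then have "cantor_point a - gap_mid (map a [0..<Suc n])
      = (cantor_point (a \<circ> Suc) - gap_mid (map (a \<circ> Suc) [0..<n])) / 3"
    by (subst cantor_point_rec) (simp add: field_simps)
  then have "\<bar>cantor_point a - gap_mid (map a [0..<Suc n])\<bar>
      = \<bar>cantor_point (a \<circ> Suc) - gap_mid (map (a \<circ> Suc) [0..<n])\<bar> / 3"
    by (simp only: abs_divide abs_numeral)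
  also have "\<dots> \<le> (1/3) ^ n / 3" by (intro divide_right_mono Suc.IH) simp
  finally show ?case by (simp only: power_third_Suc)
qed

text \<open>The constant 12 is twice the 6 of \<open>dist_gap_mid\<close>: two radii add up to at
  most the distance of the midpoints.\<close>

lemma disjoint_balls_gap_mid: "disjoint_balls gap_mid (\<lambda>s. (1/3) ^ length s / 12)"
  unfolding disjoint_balls_def
proof (intro allI impI, rule ccontr)
  fix s s' :: "bool list" and z
  assume z: "\<bar>z - gap_mid s\<bar> < (1/3) ^ length s / 12" "\<bar>z - gap_mid s'\<bar> < (1/3) ^ length s' / 12"
    and "s \<noteq> s'"
  let ?m = "min (length s) (length s')"
  have "(1/3::real) ^ length s \<le> (1/3) ^ ?m" "(1/3::real) ^ length s' \<le> (1/3) ^ ?m"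
    by (auto intro!: power_decreasing)
  then show False using z dist_gap_mid[OF \<open>s \<noteq> s'\<close>] by linarith
qed

text \<open>A continuous 2-periodic function that is 0 on [0, 1/3] and 1 on [2/3, 1], as in
  Schoenberg's construction. Clipping a cosine gives continuity and periodicity at once.\<close>

definition digit_fun :: "real \<Rightarrow> real" where
  "digit_fun t = max 0 (min 1 (1 / 2 - cos (pi * t)))"

lemma digit_fun_bounds: "0 \<le> digit_fun t" "digit_fun t \<le> 1"
  by (auto simp: digit_fun_def)

lemma digit_fun_add_even: "digit_fun (2 * of_nat n + t) = digit_fun t"
proof -
  have "cos (pi * (2 * of_nat n + t)) = cos (2 * real n * pi + pi * t)"
    by (rule arg_cong[of _ _ cos]) (simp add: algebra_simps)
  then show ?thesis by (simp add: digit_fun_def cos_add cos_2npi sin_2npi)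
qed

text \<open>Multiplication by \<open>3 ^ k\<close> shifts the ternary expansion. The integer part
  split off is even, since all digits are 0 or 2, so periodicity discards it and only the leading
  remaining digit decides the value.\<close>

lemma digit_fun_cantor_point: "digit_fun (3 ^ k * cantor_point a) = of_bool (a k)"
proof (induction k arbitrary: a)
  case 0
  have b: "0 \<le> cantor_point (a \<circ> Suc)" "cantor_point (a \<circ> Suc) \<le> 1"
    by (rule cantor_point_bounds)+
  show ?case
  proof (cases "a 0")
    case True
    then have x: "2 / 3 \<le> cantor_point a" "cantor_point a \<le> 1"
      using b cantor_point_rec[of a] by auto
    have "cos (pi * cantor_point a) \<le> cos (pi * (2 / 3))"
      using x by (intro cos_monotone_0_pi_le) auto
    also have "\<dots> = - 1 / 2" using cos_120 by (simp add: mult_ac)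
    finally show ?thesis using True by (simp add: digit_fun_def)
  next
    case False
    then have x: "cantor_point a \<le> 1 / 3" "0 \<le> cantor_point a"
      using b cantor_point_rec[of a] by auto
    have "cos (pi * (1 / 3)) \<le> cos (pi * cantor_point a)"
      using x by (intro cos_monotone_0_pi_le) auto
    moreover have "cos (pi * (1 / 3)) = 1 / 2" using cos_60 by simp
    ultimately show ?thesis using False by (simp add: digit_fun_def)
  qed
next
  case (Suc k)
  have "3 ^ Suc k * cantor_point a = 2 * of_nat (3 ^ k * of_bool (a 0)) + 3 ^ k * cantor_point (a \<circ> Suc)"
    by (subst cantor_point_rec) (simp add: field_simps)
  then show ?case using Suc[of "a \<circ> Suc"] by (simp only: digit_fun_add_even) simp
qed

text \<open>Schoenberg's space-filling curve: \<open>(schoenberg 0, schoenberg 1)\<close> maps the Cantor set onto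
  the unit square, reading off the even and the odd digits.\<close>

definition schoenberg :: "nat \<Rightarrow> real \<Rightarrow> real" where
  "schoenberg i t = (\<Sum>k. digit_fun (3 ^ (2 * k + i) * t) * (1/2) ^ Suc k)"

lemma summable_schoenberg: "summable (\<lambda>k. digit_fun (3 ^ (2 * k + i) * t) * (1/2) ^ Suc k)"
proof (rule summable_comparison_test')
  show "summable (\<lambda>k. (1/2::real) ^ Suc k)" using power_half_series by (rule sums_summable)
qed (use digit_fun_bounds in \<open>simp add: abs_mult mult_le_cancel_right1\<close>)

lemma schoenberg_bounds: "0 \<le> schoenberg i t" "schoenberg i t \<le> 1"
proof -
  show "0 \<le> schoenberg i t"
    unfolding schoenberg_def by (intro suminf_nonneg summable_schoenberg) (simp add: digit_fun_bounds)
  have "schoenberg i t \<le> (\<Sum>k. (1/2::real) ^ Suc k)"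
    unfolding schoenberg_def using digit_fun_bounds sums_summable[OF power_half_series]
    by (intro suminf_le summable_schoenberg) (auto simp: mult_le_cancel_right1)
  then show "schoenberg i t \<le> 1" using power_half_series by (simp add: sums_iff)
qed

lemma continuous_on_schoenberg: "continuous_on UNIV (schoenberg i)"
proof (rule uniform_limit_theorem)
  show "uniform_limit UNIV (\<lambda>n t. \<Sum>k<n. digit_fun (3 ^ (2 * k + i) * t) * (1/2) ^ Suc k)
      (schoenberg i) sequentially"
    unfolding schoenberg_def
  proof (rule Weierstrass_m_test)
    show "summable (\<lambda>k. (1/2::real) ^ Suc k)" using power_half_series by (rule sums_summable)
  qed (use digit_fun_bounds in \<open>simp add: abs_mult mult_le_cancel_right1\<close>)
  show "\<forall>\<^sub>F n in sequentially. continuous_on UNIV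
      (\<lambda>t. \<Sum>k<n. digit_fun (3 ^ (2 * k + i) * t) * (1/2) ^ Suc k)"
    unfolding digit_fun_def by (intro always_eventually allI continuous_intros)
qed simp

lemma schoenberg_onto:
  assumes "0 \<le> u" "u \<le> 1" "0 \<le> v" "v \<le> 1"
  obtains a where "schoenberg 0 (cantor_point a) = u" "schoenberg 1 (cantor_point a) = v"
proof -
  obtain c d where c: "(\<lambda>k. of_bool (c k) * (1/2) ^ Suc k) sums u"
    and d: "(\<lambda>k. of_bool (d k) * (1/2) ^ Suc k) sums v"
    using binary_expansion_exists assms by metis
  define a where "a n = (if even n then c (n div 2) else d (n div 2))" for n :: nat
  have "schoenberg 0 (cantor_point a) = u"
    using c unfolding schoenberg_def digit_fun_cantor_point by (simp add: a_def sums_iff)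
  moreover have "schoenberg 1 (cantor_point a) = v"
    using d unfolding schoenberg_def digit_fun_cantor_point by (simp add: a_def sums_iff)
  ultimately show ?thesis by (rule that)
qed

section \<open>A profile with all Clarke subdifferentials\<close>

text \<open>Squaring removes the corner of the positive part at 0; this gives the bump below a
  continuous derivative.\<close>

lemma DERIV_max_0_power2:
  "((\<lambda>x::real. (max 0 x)^2) has_real_derivative 2 * max 0 x) (at x)"
proof -
  consider "x < 0" | "x = 0" | "x > 0" by linarith
  then show ?thesis
  proof cases
    case 1
    have "((\<lambda>x::real. (max 0 x)^2) has_real_derivative 0) (at x)"
      by (rule has_field_derivative_transform_within_open[of "\<lambda>_. 0" _ _ "{..<0}"])
        (use 1 in auto)
    then show ?thesis using 1 by simp
  next
    case 2
    have "((\<lambda>x::real. (max 0 x)^2) has_real_derivative 0) (at 0)"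
      by (rule DERIV_zero_of_quadratic_bound[where K = 1]) (auto simp: max_def)
    then show ?thesis using 2 by simp
  next
    case 3
    have "((\<lambda>x::real. (max 0 x)^2) has_real_derivative 2 * x) (at x)"
      by (rule has_field_derivative_transform_within_open[of "\<lambda>x. x^2" _ _ "{0<..}"])
        (use 3 in \<open>auto intro!: derivative_eq_intros\<close>)
    then show ?thesis using 3 by simp
  qed
qed

text \<open>The squared positive part of 1 - z^2 is normalised so that its derivative attains both 1
  and -1 but never leaves [-1, 1]. Attaining both values is what lets an oscillation of amplitude R
  reach both M - R and M + R.\<close>

lemma bump_exists:
  "\<exists>B B' :: real \<Rightarrow> real. (\<forall>z. (B has_real_derivative B' z) (at z)) \<and> continuous_on UNIV B' \<and>
     (\<forall>z. 1 \<le> \<bar>z\<bar> \<longrightarrow> B z = 0 \<and> B' z = 0) \<and> (\<forall>z. \<bar>B z\<bar> \<le> 1) \<and> (\<forall>z. \<bar>B' z\<bar> \<le> 1) \<and>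
     (\<exists>z. \<bar>z\<bar> < 1 \<and> B' z = 1) \<and> (\<exists>z. \<bar>z\<bar> < 1 \<and> B' z = -1)"
proof -
  \<comment> \<open>The function \<open>4 * \<bar>z\<bar> * (1 - z^2)\<close> has its maximum on
    [-1, 1] at |z| = 1 / sqrt 3, with value 8 / (3 * sqrt 3); \<open>c\<close> is the
    reciprocal.\<close>
  define c :: real where "c = 3 * sqrt 3 / 8"
  define B where "B z = c * (max 0 (1 - z^2))^2" for z :: real
  define B' where "B' z = - 4 * c * z * max 0 (1 - z^2)" for z :: real
  have c: "c > 0" "c^2 = 27 / 64" by (auto simp: c_def power_divide power_mult_distrib)
  have c1: "c \<le> 1" by (rule power2_le_imp_le) (use c in auto)
  have out: "max 0 (1 - z^2) = 0" if "1 \<le> \<bar>z\<bar>" for z :: real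
    using that by (simp add: max_def abs_le_square_iff[of 1 z, simplified])
  have der: "(B has_real_derivative B' z) (at z)" for z
  proof -
    have "((\<lambda>z. (max 0 (1 - z^2))^2) has_real_derivative 2 * max 0 (1 - z^2) * (- 2 * z)) (at z)"
      by (rule DERIV_chain2[OF DERIV_max_0_power2]) (auto intro!: derivative_eq_intros)
    then have "(B has_real_derivative c * (2 * max 0 (1 - z^2) * (- 2 * z))) (at z)"
      unfolding B_def by (rule DERIV_cmult)
    then show ?thesis by (simp add: B'_def mult_ac)
  qed
  have B1: "\<bar>B z\<bar> \<le> 1" for z
  proof -
    have "max 0 (1 - z^2) \<le> 1" by simp
    then have "(max 0 (1 - z^2))^2 \<le> 1^2" by (intro power_mono) auto
    then show ?thesis using c c1 mult_mono[of c 1 "(max 0 (1 - z^2))^2" 1]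
      by (simp add: B_def abs_mult)
  qed
  \<comment> \<open>With t = z^2 this bounds the square of \<open>B'\<close>. The maximum is at t =
    1/3, which is therefore a double root of the difference.\<close>
  have poly: "t * (1 - t)^2 \<le> 4 / 27" if "0 \<le> t" "t \<le> 1" for t :: real
  proof -
    have "4 / 27 - t * (1 - t)^2 = (t - 1/3)^2 * (4/3 - t)"
      by (simp add: power2_eq_square field_simps)
    also have "\<dots> \<ge> 0" using that by (intro mult_nonneg_nonneg) auto
    finally show ?thesis by simp
  qed
  have B'1: "\<bar>B' z\<bar> \<le> 1" for z
  proof (cases "1 \<le> \<bar>z\<bar>")
    case True
    then show ?thesis by (simp add: B'_def out)
  next
    case False
    then have z: "0 \<le> z^2" "z^2 \<le> 1" by (auto simp: abs_square_le_1)
    have "(B' z)^2 = 16 * c^2 * (z^2 * (1 - z^2)^2)"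
      using z by (simp add: B'_def power_mult_distrib max_def)
    also have "\<dots> \<le> 16 * (27 / 64) * (4 / 27)"
      unfolding c(2) by (intro mult_left_mono poly z) simp
    finally have "(B' z)^2 \<le> 1" by simp
    then show ?thesis by (simp add: abs_square_le_1)
  qed
  have s: "(1 / sqrt 3)^2 = 1 / 3" "(- 1 / sqrt 3)^2 = 1 / 3" by (auto simp: power_divide)
  have "B' (1 / sqrt 3) = -1" "B' (- 1 / sqrt 3) = 1"
    unfolding B'_def s by (auto simp: c_def)
  moreover have "\<bar>1 / sqrt 3\<bar> < 1" "\<bar>- 1 / sqrt 3\<bar> < 1" by auto
  moreover have "continuous_on UNIV B'"
    unfolding B'_def by (intro continuous_intros)
  moreover have "B z = 0 \<and> B' z = 0" if "1 \<le> \<bar>z\<bar>" for z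
    using out[OF that] by (simp add: B_def B'_def)
  ultimately show ?thesis using der B1 B'1 by blast
qed

lemma profile_exists:
  obtains \<phi> g :: "real \<Rightarrow> real" where
    "\<And>x. (\<phi> has_real_derivative g x) (at x)" "\<And>x. \<bar>g x\<bar> \<le> 1" "\<And>x. 6 \<le> \<bar>x\<bar> \<Longrightarrow> \<phi> x = 0"
    "\<And>p q. -1 \<le> p \<Longrightarrow> p \<le> q \<Longrightarrow> q \<le> 1 \<Longrightarrow> \<exists>x. \<bar>x\<bar> \<le> 1 \<and> cluster_range g x p q"
proof -
  obtain B B' :: "real \<Rightarrow> real" where B: "\<And>z. (B has_real_derivative B' z) (at z)"
    "continuous_on UNIV B'" "\<And>z. 1 \<le> \<bar>z\<bar> \<Longrightarrow> B z = 0" "\<And>z. 1 \<le> \<bar>z\<bar> \<Longrightarrow> B' z = 0"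
    "\<And>z. \<bar>B z\<bar> \<le> 1" "\<And>z. \<bar>B' z\<bar> \<le> 1"
    and B1: "\<exists>z. \<bar>z\<bar> < 1 \<and> B' z = 1" "\<exists>z. \<bar>z\<bar> < 1 \<and> B' z = -1"
    using bump_exists by metis

  \<comment> \<open>Centres and half-lengths from the Schoenberg curve\<close>
  define \<kappa> :: "real \<Rightarrow> real" where "\<kappa> t = max 0 (min 1 (3 / 2 - \<bar>t - 1 / 2\<bar>))" for t
  \<comment> \<open>Up to the cutoff \<kappa>, which is 1 on [0, 1] and 0 outside (-1, 2), the pair
    \<open>(m, r)\<close> is the Schoenberg curve followed by a map of the unit square onto the
    triangle |m| + r \<le> 1, r \<ge> 0. This triangle parametrises the subintervals of [-1, 1] by
    centre and half-length.\<close>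
  define m where "m t = \<kappa> t * (2 * schoenberg 0 t - 1)" for t
  define r where "r t = schoenberg 1 t * (1 - \<bar>m t\<bar>)" for t
  have \<kappa>: "0 \<le> \<kappa> t" "\<kappa> t \<le> 1" for t by (auto simp: \<kappa>_def)
  have m1: "\<bar>m t\<bar> \<le> 1" for t
  proof -
    have "\<bar>2 * schoenberg 0 t - 1\<bar> \<le> 1" using schoenberg_bounds[of 0 t] by auto
    then have "\<bar>\<kappa> t\<bar> * \<bar>2 * schoenberg 0 t - 1\<bar> \<le> 1 * 1" using \<kappa>[of t] by (intro mult_mono) auto
    then show ?thesis by (simp add: m_def abs_mult)
  qed
  have m0: "m t = 0" if "t \<le> -1 \<or> 2 \<le> t" for t using that by (auto simp: m_def \<kappa>_def)
  have r: "0 \<le> r t" "r t \<le> 1 - \<bar>m t\<bar>" for t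
    using schoenberg_bounds[of 1 t] m1[of t] by (auto simp: r_def intro!: mult_left_le_one_le)
  have contm: "continuous_on UNIV m"
    unfolding m_def \<kappa>_def by (intro continuous_intros continuous_on_schoenberg)
  then have contr: "continuous_on UNIV r"
    unfolding r_def by (intro continuous_intros continuous_on_schoenberg)

  \<comment> \<open>Oscillating bumps in the gaps\<close>
  define d where "d s = (1/3::real) ^ length s / 12" for s :: "bool list"
  \<comment> \<open>A bump of width \<open>w s\<close> whose slope is at most 1 has height at most
    \<open>w s\<close>; the square supplies the quadratic bound of
    \<open>DERIV_patch\<close>.\<close>
  define w where "w s = (d s)^2" for s
  have d: "0 < d s" "d s \<le> 1 / 12" for s by (auto simp: d_def power_le_one)
  have w: "0 < w s" "w s \<le> d s / 2" for s
  proof -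
    show "0 < w s" using d[of s] by (simp add: w_def)
    have "d s * d s \<le> d s * (1 / 12)" using d[of s] by (intro mult_left_mono) auto
    then show "w s \<le> d s / 2" using d[of s] by (simp add: w_def power2_eq_square)
  qed
  \<comment> \<open>The amplitude of a bump is the minimum of \<open>r\<close> over it rather than the value at its midpoint, so
    that \<open>\<bar>m\<bar> + r \<le> 1\<close> keeps the derivative in \<open>[-1, 1]\<close> on the whole bump.\<close>
  have "\<exists>y. \<bar>y - gap_mid s\<bar> \<le> w s \<and> (\<forall>z. \<bar>z - gap_mid s\<bar> \<le> w s \<longrightarrow> r y \<le> r z)" for s
  proof -
    have "\<exists>y\<in>cball (gap_mid s) (w s). \<forall>z\<in>cball (gap_mid s) (w s). r y \<le> r z"
      using w(1)[of s] contr by (intro continuous_attains_inf) (auto intro: continuous_on_subset)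
    then show ?thesis by (simp add: Bex_def Ball_def dist_real_def abs_minus_commute)
  qed
  then obtain y where y: "\<And>s. \<bar>y s - gap_mid s\<bar> \<le> w s"
    "\<And>s z. \<bar>z - gap_mid s\<bar> \<le> w s \<Longrightarrow> r (y s) \<le> r z" by metis
  have ry: "0 \<le> r (y s)" "r (y s) \<le> 1" for s using r[of "y s"] by auto

  define b where "b s z = r (y s) * (w s * B ((z - gap_mid s) / w s))" for s z
  define b' where "b' s z = r (y s) * B' ((z - gap_mid s) / w s)" for s z
  define H where "H = patch gap_mid d b"
  define h where "h = patch gap_mid d b'"
  have dj: "disjoint_balls gap_mid d"
    unfolding d_def by (rule disjoint_balls_gap_mid)
  have quot: "1 \<le> \<bar>(z - gap_mid s) / w s\<bar>" if "w s \<le> \<bar>z - gap_mid s\<bar>" for s z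
    using that w(1)[of s] by (simp add: abs_divide)
  have derH: "(H has_real_derivative h x) (at x)" for x
    unfolding H_def h_def
  proof (rule DERIV_patch[OF dj])
    show "b s z = 0" if "d s / 2 < \<bar>z - gap_mid s\<bar>" for s z
      using that w(2)[of s] B(3)[OF quot[of s z]] by (simp add: b_def)
    show "\<bar>b s z\<bar> \<le> 1 * (d s)^2" for s z
    proof -
      have "\<bar>b s z\<bar> = r (y s) * (w s * \<bar>B ((z - gap_mid s) / w s)\<bar>)"
        using ry[of s] w(1)[of s] by (simp add: b_def abs_mult)
      also have "\<dots> \<le> 1 * (w s * 1)"
        using ry[of s] w(1)[of s] B(5) by (intro mult_mono) auto
      finally show ?thesis by (simp add: w_def)
    qed
    show "(b s has_real_derivative b' s z) (at z)" for s z
    proof -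
      have "((\<lambda>z. B ((z - gap_mid s) / w s)) has_real_derivative
          B' ((z - gap_mid s) / w s) * (1 / w s)) (at z)"
        by (rule DERIV_chain2[OF B(1)]) (use w(1)[of s] in \<open>auto intro!: derivative_eq_intros\<close>)
      then have "(b s has_real_derivative
          r (y s) * (w s * (B' ((z - gap_mid s) / w s) * (1 / w s)))) (at z)"
        unfolding b_def by (intro DERIV_cmult)
      then show ?thesis using w(1)[of s] by (simp add: b'_def)
    qed
  qed
  have b'0: "b' s z = 0" if "w s \<le> \<bar>z - gap_mid s\<bar>" for s z
    using B(4)[OF quot[OF that]] by (simp add: b'_def)
  have b'1: "\<bar>b' s z\<bar> \<le> r (y s)" for s z
    using ry[of s] B(6) by (simp add: b'_def abs_mult mult_left_le)
  have hm: "\<bar>h x\<bar> \<le> 1 - \<bar>m x\<bar>" for x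
    unfolding h_def
  proof (rule patch_bound[OF dj])
    show "\<bar>b' s x\<bar> \<le> 1 - \<bar>m x\<bar>" for s
    proof (cases "w s \<le> \<bar>x - gap_mid s\<bar>")
      case False
      then show ?thesis using b'1[of s x] y(2)[of x s] r(2)[of x] by linarith
    qed (use b'0 m1[of x] in simp)
  qed (use m1[of x] in simp)
  have out: "d s \<le> \<bar>x - gap_mid s\<bar>" if "x \<le> -1 \<or> 2 \<le> x" for x s
    using that d(2)[of s] gap_mid_bounds[of s] by linarith
  have H0: "H x = 0" "h x = 0" if "x \<le> -1 \<or> 2 \<le> x" for x
    using out[OF that] unfolding H_def h_def by (auto intro!: patch_out)

  \<comment> \<open>The compactly supported profile\<close>
  obtain A where A: "\<And>x. (A has_real_derivative m x) (at x)"
  proof -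
    have "\<exists>F. \<forall>x :: real. -\<infinity> < ereal x \<longrightarrow> ereal x < \<infinity> \<longrightarrow> (F has_vector_derivative m x) (at x)"
      by (rule einterval_antiderivative)
        (use contm in \<open>auto simp: continuous_on_eq_continuous_at\<close>)
    then show ?thesis using that by (auto simp: has_real_derivative_iff_has_vector_derivative)
  qed
  have A_left: "A x = A (-1)" if "x \<le> -1" for x
  proof (cases "x = -1")
    case False
    have "(A has_real_derivative 0) (at z)" if "z \<le> -1" for z
      using A[of z] m0[of z] that by simp
    then show ?thesis using that False
      by (intro DERIV_isconst_end[symmetric, of x "-1" A]) (auto intro!: continuous_at_imp_continuous_on DERIV_isCont A)
  qed simp
  have A_right: "A x = A 2" if "2 \<le> x" for x
  proof (cases "x = 2")
    case False
    have "(A has_real_derivative 0) (at z)" if "2 \<le> z" for z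
      using A[of z] m0[of z] that by simp
    then show ?thesis using that False
      by (intro DERIV_isconst_end[of 2 x A]) (auto intro!: continuous_at_imp_continuous_on DERIV_isCont A)
  qed simp

  \<comment> \<open>Subtracting a translate makes the antiderivative of \<open>m\<close> compactly supported.\<close>
  define \<phi> where "\<phi> x = A x - A (x - 4) + H x" for x
  define g where "g x = m x - m (x - 4) + h x" for x
  have "(\<phi> has_real_derivative g x) (at x)" for x
  proof -
    have "((\<lambda>x. A (x - 4)) has_real_derivative m (x - 4) * 1) (at x)"
      by (rule DERIV_chain2[OF A]) (auto intro!: derivative_eq_intros)
    then show ?thesis
      unfolding \<phi>_def g_def by (intro DERIV_add DERIV_diff A derH) simp
  qed
  moreover have "\<bar>g x\<bar> \<le> 1" for x
  \<comment> \<open>\<open>m\<close> and \<open>h\<close> vanish outside (-1, 2) and the translate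
    of \<open>m\<close> outside (3, 6); the point 5/2 separates the two ranges, so the bounds do not
    add up.\<close>
  proof (cases "x < 5 / 2")
    case True
    then show ?thesis using m0[of "x - 4"] hm[of x] by (simp add: g_def)
  next
    case False
    then show ?thesis using m0[of x] H0[of x] m1[of "x - 4"] by (simp add: g_def)
  qed
  moreover have "\<phi> x = 0" if "6 \<le> \<bar>x\<bar>" for x
  proof (cases "x \<ge> 0")
    case True
    then show ?thesis using that A_right[of x] A_right[of "x - 4"] H0[of x] by (simp add: \<phi>_def)
  next
    case False
    then show ?thesis using that A_left[of x] A_left[of "x - 4"] H0[of x] by (simp add: \<phi>_def)
  qed

  \<comment> \<open>Every subinterval of [-1, 1] as a cluster range\<close>
  moreover have "\<exists>x. \<bar>x\<bar> \<le> 1 \<and> cluster_range g x p q" if pq: "-1 \<le> p" "p \<le> q" "q \<le> 1" for p q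
  proof -
    define M where "M = (p + q) / 2"
    define R where "R = (q - p) / 2"
    \<comment> \<open>If |M| = 1 then \<open>R = 0\<close>, and division by zero yields the suitable
      value \<open>v = 0\<close>.\<close>
    define v where "v = R / (1 - \<bar>M\<bar>)"
    have R: "0 \<le> R" "R \<le> 1 - \<bar>M\<bar>" "p = M - R" "q = M + R"
      using pq by (auto simp: M_def R_def field_simps abs_if)
    have v: "0 \<le> v" "v \<le> 1" "v * (1 - \<bar>M\<bar>) = R"
      using R by (auto simp: v_def divide_le_eq_1)
    obtain a where a: "schoenberg 0 (cantor_point a) = (M + 1) / 2"
      "schoenberg 1 (cantor_point a) = v"
      by (rule schoenberg_onto[of "(M + 1) / 2" v]) (use pq v in \<open>auto simp: M_def field_simps\<close>)
    define x where "x = cantor_point a"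
    have x: "0 \<le> x" "x \<le> 1" using cantor_point_bounds by (auto simp: x_def)
    have mx: "m x = M" using a x by (simp add: m_def \<kappa>_def x_def field_simps)
    have rx: "r x = R" using a v mx by (simp add: r_def x_def)
    have far: "d s \<le> \<bar>x - gap_mid s\<bar>" for s
      unfolding x_def by (rule order_trans[OF _ dist_cantor_point_gap_mid]) (simp add: d_def)
    have close: "\<exists>\<delta>>0. \<forall>z. \<bar>z - x\<bar> < \<delta> \<longrightarrow> \<bar>f z - f x\<bar> < e"
      if "continuous_on UNIV f" "0 < e" for f :: "real \<Rightarrow> real" and e
      using that unfolding continuous_on_iff by (auto simp: dist_real_def)
    have "cluster_range g x p q"
      unfolding cluster_range_def
    proof (intro conjI allI impI ballI)
      fix e :: real assume e: "0 < e"
      obtain \<delta>1 where \<delta>1: "\<delta>1 > 0" "\<And>z. \<bar>z - x\<bar> < \<delta>1 \<Longrightarrow> \<bar>m z - M\<bar> < e / 2"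
        using close[OF contm, of "e / 2"] e mx by auto
      obtain \<delta>2 where \<delta>2: "\<delta>2 > 0" "\<And>z. \<bar>z - x\<bar> < \<delta>2 \<Longrightarrow> \<bar>r z - R\<bar> < e / 2"
        using close[OF contr, of "e / 2"] e rx by auto
      \<comment> \<open>The 1 keeps \<open>z - 4\<close> outside the support of \<open>m\<close>.
        For a bump over \<open>z\<close>, the distance of its centre from \<open>x\<close> is at
        least \<open>d s\<close>, so \<open>w s \<le> \<bar>z - x\<bar>\<close> and
        \<open>y s\<close> is within three times \<open>\<bar>z - x\<bar>\<close> of
        \<open>x\<close>; hence the third of \<delta>2.\<close>
      have "\<forall>\<^sub>F z in nhds x. z \<in> ball x (min 1 (min \<delta>1 (\<delta>2 / 3)))"
        using \<delta>1 \<delta>2 by (intro eventually_nhds_in_open) auto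
      then show "\<forall>\<^sub>F z in nhds x. p - e \<le> g z \<and> g z \<le> q + e"
      proof eventually_elim
        case (elim z)
        then have "\<bar>z - x\<bar> < min 1 (min \<delta>1 (\<delta>2 / 3))"
          by (simp only: mem_ball dist_real_def abs_minus_commute)
        then have z: "\<bar>z - x\<bar> < 1" "\<bar>z - x\<bar> < \<delta>1" "3 * \<bar>z - x\<bar> < \<delta>2"
          by auto
        have "\<bar>h z\<bar> \<le> R + e / 2"
          unfolding h_def
        proof (rule patch_bound[OF dj])
          show "\<bar>b' s z\<bar> \<le> R + e / 2" for s
          proof (cases "w s \<le> \<bar>z - gap_mid s\<bar>")
            case True
            then show ?thesis using b'0 R e by simp
          next
            case False
            then have "\<bar>z - gap_mid s\<bar> < w s" by simp
            then have "\<bar>y s - x\<bar> < \<delta>2"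
              using y(1)[of s] w(2)[of s] far[of s] z(3) by argo
            then show ?thesis using \<delta>2(2)[of "y s"] b'1[of s z] by linarith
          qed
        qed (use R e in simp)
        moreover have "m (z - 4) = 0" using z x by (intro m0) auto
        ultimately show ?case using \<delta>1(2)[OF z(2)] R unfolding g_def by linarith
      qed
    next
      fix v e :: real and V assume v: "v \<in> {p, q}" and e: "0 < e" and V: "open V \<and> x \<in> V"
      then obtain \<eta> where \<eta>: "\<eta> > 0" "ball x \<eta> \<subseteq> V" using open_contains_ball by blast
      \<comment> \<open>The sign \<sigma> selects the endpoint, and \<zeta> is a place in the bump
        where the slope attains that sign.\<close>
      obtain \<sigma> where \<sigma>: "\<bar>\<sigma>\<bar> = 1" "v = M + \<sigma> * R"
        using v R by (cases "v = q") (auto intro: that[of 1] that[of "-1"])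
      then obtain \<zeta> where \<zeta>: "\<bar>\<zeta>\<bar> < 1" "B' \<zeta> = \<sigma>" using B1 by (cases "\<sigma> = 1") auto
      obtain \<delta>1 where \<delta>1: "\<delta>1 > 0" "\<And>z. \<bar>z - x\<bar> < \<delta>1 \<Longrightarrow> \<bar>m z - M\<bar> < e / 3"
        using close[OF contm, of "e / 3"] e mx by auto
      obtain \<delta>2 where \<delta>2: "\<delta>2 > 0" "\<And>z. \<bar>z - x\<bar> < \<delta>2 \<Longrightarrow> \<bar>r z - R\<bar> < e / 3"
        using close[OF contr, of "e / 3"] e rx by auto
      define \<delta> where "\<delta> = min 1 (min \<eta> (min \<delta>1 \<delta>2))"
      have "\<delta> > 0" using \<eta> \<delta>1 \<delta>2 by (simp add: \<delta>_def)
      then obtain n where n: "(1/3::real) ^ n < \<delta> / 2"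
        using real_arch_pow_inv[of "\<delta> / 2" "1/3"] by auto
      \<comment> \<open>The gap addressed by the first \<open>n\<close> digits of \<open>x\<close>:
        its midpoint is within \<open>(1/3) ^ n\<close> of \<open>x\<close>, and the bump adds at
        most as much again.\<close>
      define s where "s = map a [0..<n]"
      have "d s \<le> (1/3) ^ n" by (simp add: d_def s_def)
      then have near: "\<bar>z - x\<bar> < \<delta>" if "\<bar>z - gap_mid s\<bar> \<le> w s" for z
        using that gap_mid_prefix[of a n, folded x_def s_def] w(2)[of s] d(1)[of s] n by linarith
      define U where "U = {z. \<bar>z - gap_mid s\<bar> < w s} \<inter> {z. \<bar>B' ((z - gap_mid s) / w s) - \<sigma>\<bar> < e / 3}"
      have "open U"
        unfolding U_def
        by (intro open_Int open_Collect_less continuous_intros continuous_on_compose2[OF B(2)])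
          (use w(1)[of s] in auto)
      moreover have "gap_mid s + w s * \<zeta> \<in> U"
        using w(1)[of s] \<zeta> e by (simp add: U_def abs_mult)
      moreover have "U \<subseteq> V"
        using near \<eta> by (fastforce simp: U_def \<delta>_def dist_real_def abs_minus_commute)
      moreover have "\<bar>g z - v\<bar> < e" if z: "z \<in> U" for z
      proof -
        have zw: "\<bar>z - gap_mid s\<bar> \<le> w s" using z by (simp add: U_def)
        then have zx: "\<bar>z - x\<bar> < \<delta>" by (rule near)
        have "h z = b' s z"
          unfolding h_def by (rule patch_in[OF dj]) (use zw w(2)[of s] d(1)[of s] in linarith)
        moreover have "m (z - 4) = 0" using zx x by (intro m0) (auto simp: \<delta>_def)
        ultimately have "g z = m z + r (y s) * B' ((z - gap_mid s) / w s)"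
          by (simp add: g_def b'_def)
        moreover have "\<bar>m z - M\<bar> < e / 3" using zx by (intro \<delta>1) (simp add: \<delta>_def)
        moreover have "\<bar>r (y s) * B' ((z - gap_mid s) / w s) - \<sigma> * R\<bar> < 2 * (e / 3)"
        proof -
          let ?\<beta> = "B' ((z - gap_mid s) / w s)"
          have "\<bar>r (y s) * (?\<beta> - \<sigma>)\<bar> \<le> 1 * \<bar>?\<beta> - \<sigma>\<bar>"
            unfolding abs_mult using ry[of s] by (intro mult_right_mono) auto
          also have "\<dots> < e / 3" using z by (simp add: U_def)
          finally have "\<bar>r (y s) * (?\<beta> - \<sigma>)\<bar> < e / 3" .
          moreover have "\<bar>\<sigma> * (r (y s) - R)\<bar> < e / 3"
            using \<delta>2(2)[of "y s"] near[OF y(1)[of s]] \<sigma> by (simp add: abs_mult \<delta>_def)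
          moreover have "r (y s) * ?\<beta> - \<sigma> * R = r (y s) * (?\<beta> - \<sigma>) + \<sigma> * (r (y s) - R)"
            by (simp add: algebra_simps)
          ultimately show ?thesis by linarith
        qed
        ultimately show ?thesis using \<sigma>(2) by linarith
      qed
      ultimately show "\<exists>U. open U \<and> U \<noteq> {} \<and> U \<subseteq> V \<and> (\<forall>z\<in>U. \<bar>g z - v\<bar> < e)"
        by blast
    qed
    then show ?thesis using x by (intro exI[of _ x]) auto
  qed
  ultimately show ?thesis by (rule that)
qed

section \<open>A closed infinite-dimensional space\<close>

lemma Lip_iff:
  "f \<in> Lip I \<longleftrightarrow> (\<forall>x. x \<notin> I \<longrightarrow> f x = 0) \<and>
     (\<exists>L\<ge>0. \<forall>x\<in>I. \<forall>y\<in>I. \<bar>f x - f y\<bar> \<le> L * \<bar>x - y\<bar>)"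
  by (auto simp: Lip_def lipschitz_on_def dist_real_def)

lemma Lip_diff:
  assumes "f \<in> Lip I" "g \<in> Lip I"
  shows "f - g \<in> Lip I"
proof -
  obtain L M where "0 \<le> L" "\<forall>x\<in>I. \<forall>y\<in>I. \<bar>f x - f y\<bar> \<le> L * \<bar>x - y\<bar>"
    "0 \<le> M" "\<forall>x\<in>I. \<forall>y\<in>I. \<bar>g x - g y\<bar> \<le> M * \<bar>x - y\<bar>"
    using assms unfolding Lip_iff by blast
  then have "0 \<le> L + M \<and> (\<forall>x\<in>I. \<forall>y\<in>I. \<bar>(f - g) x - (f - g) y\<bar> \<le> (L + M) * \<bar>x - y\<bar>)"
    by (simp add: distrib_right) (smt (verit))
  then show ?thesis using assms unfolding Lip_iff by auto
qed

lemma Lip_norm_bound: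
  assumes "f \<in> Lip I" "x \<in> I" "y \<in> I"
  shows "\<bar>f x - f y\<bar> \<le> Lip_norm I f * \<bar>x - y\<bar>"
proof (cases "x = y")
  case False
  let ?S = "{\<bar>f x - f y\<bar> / \<bar>x - y\<bar> | x y. x \<in> I \<and> y \<in> I \<and> x \<noteq> y}"
  obtain L where "\<forall>x\<in>I. \<forall>y\<in>I. \<bar>f x - f y\<bar> \<le> L * \<bar>x - y\<bar>"
    using assms(1) unfolding Lip_iff by blast
  then have "bdd_above ?S"
    by (intro bdd_aboveI[of _ L]) (auto simp: pos_divide_le_eq)
  then have "\<bar>f x - f y\<bar> / \<bar>x - y\<bar> \<le> Lip_norm I f"
    unfolding Lip_norm_def by (rule cSup_upper[rotated]) (use assms False in blast)
  then show ?thesis using False by (simp add: divide_simps)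
qed simp

text \<open>Two distinct points make the set of difference quotients nonempty, so that its
  \<open>Sup\<close> is a genuine least upper bound.\<close>

lemma Lip_norm_le:
  assumes "x \<in> I" "y \<in> I" "x \<noteq> y" "\<And>x y. x \<in> I \<Longrightarrow> y \<in> I \<Longrightarrow> \<bar>f x - f y\<bar> \<le> L * \<bar>x - y\<bar>"
  shows "Lip_norm I f \<le> L"
  unfolding Lip_norm_def
proof (rule cSup_least)
  show "{\<bar>f x - f y\<bar> / \<bar>x - y\<bar> | x y. x \<in> I \<and> y \<in> I \<and> x \<noteq> y} \<noteq> {}" using assms(1-3) by blast
qed (use assms(4) in \<open>auto simp: pos_divide_le_eq\<close>)

text \<open>Only finitely many terms are as large as a given nonzero one. This is why null sequences
  serve as coefficients: a supremum that is not attained would leave no single piece reaching the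
  full seminorm.\<close>

lemma null_sequence_attains_max:
  fixes c :: "nat \<Rightarrow> real"
  assumes "c \<longlonglongrightarrow> 0"
  obtains m where "\<And>n. \<bar>c n\<bar> \<le> \<bar>c m\<bar>"
proof (cases "\<exists>k. c k \<noteq> 0")
  case True
  then obtain k where k: "c k \<noteq> 0" by blast
  obtain n0 where n0: "\<And>n. n \<ge> n0 \<Longrightarrow> \<bar>c n\<bar> < \<bar>c k\<bar>"
    using LIMSEQ_D[OF assms, of "\<bar>c k\<bar>"] k by auto
  let ?A = "(\<lambda>n. \<bar>c n\<bar>) ` insert k {..<n0}"
  have "Max ?A \<in> ?A" by (intro Max_in) auto
  then obtain m where m: "\<bar>c m\<bar> = Max ?A" by auto
  have "\<bar>c n\<bar> \<le> \<bar>c m\<bar>" for n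
  proof (cases "n < n0")
    case True
    then show ?thesis unfolding m by (intro Max_ge) auto
  next
    case False
    then have "\<bar>c n\<bar> \<le> \<bar>c k\<bar>" using n0[of n] by simp
    also have "\<dots> \<le> \<bar>c m\<bar>" unfolding m by (intro Max_ge) auto
    finally show ?thesis .
  qed
  then show ?thesis by (rule that)
qed (use that in auto)

text \<open>The functionals \<open>coef n\<close> are biorthogonal to the vectors
  \<open>e k\<close>, which are therefore distinct and independent; a finite set cannot span
  infinitely many independent vectors.\<close>

lemma infinite_dimensionalI:
  assumes e: "range e \<subseteq> W"
    and coef_add: "\<And>n f g. coef n (f + g) = coef n f + coef n g"
    and coef_scale: "\<And>n k f. coef n (k *\<^sub>R f) = k * coef n f"
    and dual: "\<And>n k :: nat. coef n (e k) = (if k = n then 1 else 0 :: real)"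
  shows "infinite_dimensional W"
  unfolding infinite_dimensional_def
proof
  assume "\<exists>B. finite B \<and> span B = W"
  then obtain B where B: "finite B" "span B = W" by blast
  have coef_0: "coef n 0 = 0" for n
    using coef_scale[of n 0 0] by simp
  have "independent (range e)"
    unfolding dependent_def
  proof
    assume "\<exists>x\<in>range e. x \<in> span (range e - {x})"
    then obtain n where n: "e n \<in> span (range e - {e n})" by blast
    have "coef n (e n) = 0"
    proof (rule span_induct[OF n])
      show "subspace {f. coef n f = 0}"
        by (simp add: subspace_def coef_0 coef_add coef_scale)
      show "coef n f = 0" if "f \<in> range e - {e n}" for f
        using that dual by auto
    qed
    then show False using dual by simp
  qed
  then have "finite (range e)"
    using independent_span_bound[OF B(1)] e B(2) by blast
  moreover have "inj e"
    using dual by (intro injI) (metis zero_neq_one)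
  ultimately show False
    using finite_imageD by blast
qed

lemma spaceable_diff_clarke_exhaustive_of_profile:
  fixes \<phi> g :: "real \<Rightarrow> real"
  assumes I: "open I" "I \<noteq> {}" and N: "N \<in> null_sets lebesgue"
    and der: "\<And>x. (\<phi> has_real_derivative g x) (at x)"
    and g1: "\<And>x. \<bar>g x\<bar> \<le> 1"
    and supp: "\<And>x. 6 \<le> \<bar>x\<bar> \<Longrightarrow> \<phi> x = 0"
    and range: "\<And>p q. -1 \<le> p \<Longrightarrow> p \<le> q \<Longrightarrow> q \<le> 1 \<Longrightarrow> \<exists>x. \<bar>x\<bar> \<le> 1 \<and> cluster_range g x p q"
  shows "spaceable (Lip I) (Lip_dist I) (diff_clarke_exhaustive N I)"
proof -
  \<comment> \<open>A zero profile would have zero derivative and could not have 1 as a cluster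
    value. The point \<alpha> later serves to read off coefficients.\<close>
  obtain \<alpha> where \<alpha>: "\<phi> \<alpha> \<noteq> 0"
  proof (rule ccontr)
    assume "\<not> thesis"
    then have "\<phi> = (\<lambda>_. 0)" using that by auto
    then have g0: "g x = 0" for x
      using der[of x] by (auto intro: DERIV_unique[OF _ DERIV_const])
    obtain x where "cluster_range g x 1 1" using range[of 1 1] by auto
    then have "\<forall>e>0. \<forall>\<^sub>F y in nhds x. 1 - e \<le> g y \<and> g y \<le> 1 + e"
      unfolding cluster_range_def by blast
    then have "\<forall>\<^sub>F y in nhds x. 1 - 1 / 2 \<le> g y \<and> g y \<le> 1 + 1 / 2"
      by (rule allE[of _ "1 / 2"]) simp
    then show False using g0 by (auto dest: eventually_nhds_x_imp_x)
  qed
  then have \<alpha>6: "\<bar>\<alpha>\<bar> < 6" using supp[of \<alpha>] by linarith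
  \<comment> \<open>12 is the length of [-6, 6]; the mean value theorem is applied from the zero at
    6.\<close>
  have \<phi>12: "\<bar>\<phi> z\<bar> \<le> 12" for z
  proof (cases "\<bar>z\<bar> < 6")
    case True
    have "norm (\<phi> z - \<phi> 6) \<le> 1 * norm (z - 6)"
      using der g1 by (intro field_differentiable_bound[of UNIV \<phi> g]) auto
    then show ?thesis using supp[of 6] True by auto
  qed (use supp in simp)

  \<comment> \<open>Position and scale of the copies\<close>
  obtain x0 where x0: "x0 \<in> I" using I by blast
  obtain \<delta>' where \<delta>': "\<delta>' > 0" "ball x0 \<delta>' \<subseteq> I" using I(1) x0 open_contains_ball by blast
  define \<delta> where "\<delta> = min 1 (\<delta>' / 2)"
  have \<delta>: "0 < \<delta>" "\<delta> \<le> 1" and ball: "\<And>x. \<bar>x - x0\<bar> < 2 * \<delta> \<Longrightarrow> x \<in> I"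
    using \<delta>' by (auto simp: \<delta>_def dist_real_def abs_minus_commute subset_iff)

  \<comment> \<open>The centres approach \<open>x0\<close> geometrically. For m < n they differ by
    at least \<open>s m / 2\<close>, more than the sum of the two radii. The choice of
    \<open>w\<close> gives copies of height at most \<open>12 * w n = (d n)^2\<close>, supported
    within \<open>6 * w n \<le> d n / 2\<close> of the centre.\<close>
  define s where "s n = \<delta> / 2 ^ n" for n :: nat
  define t where "t n = x0 + s n" for n
  define d where "d n = s n / 8" for n
  define w where "w n = (d n)^2 / 12" for n
  have s: "0 < s n" "s n \<le> \<delta>" for n
    using \<delta> by (auto simp: s_def divide_le_eq mult_le_cancel_left1)
  have s_half: "s n \<le> s m / 2" if "m < n" for m n
  proof -
    have "(2::real) * 2 ^ m \<le> 2 ^ n" using that power_increasing[of "Suc m" n "2::real"] by simp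
    then have "\<delta> / 2 ^ n \<le> \<delta> / (2 * 2 ^ m)" using \<delta> by (intro divide_left_mono) auto
    then show ?thesis by (simp add: s_def)
  qed
  have d: "0 < d n" "d n \<le> 1" for n using s[of n] \<delta> by (auto simp: d_def)
  have w: "0 < w n" "6 * w n \<le> d n / 2" for n
    using d[of n] by (auto simp: w_def power2_eq_square mult_left_le)
  have dj: "disjoint_balls t d"
  proof -
    have "False" if z: "\<bar>z - t m\<bar> < d m" "\<bar>z - t n\<bar> < d n" and "m < n" for m n z
      using z s_half[OF \<open>m < n\<close>] s(1)[of n] unfolding t_def d_def by linarith
    then show ?thesis unfolding disjoint_balls_def by (metis linorder_neqE_nat)
  qed
  have near: "x \<in> I" if "\<bar>x - t n\<bar> < d n" for x n
    using that s[of n] unfolding t_def d_def by (intro ball) linarith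

  \<comment> \<open>Superposition of the copies\<close>
  define F where "F c = patch t d (\<lambda>n z. c n * (w n * \<phi> ((z - t n) / w n)))" for c
  define G where "G c = patch t d (\<lambda>n z. c n * g ((z - t n) / w n))" for c
  have F_in: "F c z = c n * (w n * \<phi> ((z - t n) / w n))" if "\<bar>z - t n\<bar> < d n" for c n z
    unfolding F_def by (rule patch_in[OF dj that])
  have G_in: "G c z = c n * g ((z - t n) / w n)" if "\<bar>z - t n\<bar> < d n" for c n z
    unfolding G_def by (rule patch_in[OF dj that])
  have F_add: "F (\<lambda>n. c n + c' n) z = F c z + F c' z" for c c' z
    by (simp add: F_def patch_def distrib_right sum.distrib)
  have F_scale: "F (\<lambda>n. k * c n) z = k * F c z" for c k z
    by (simp add: F_def patch_def sum_distrib_left mult.assoc)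
  have F_diff: "F (\<lambda>n. c n - c' n) z = F c z - F c' z" for c c' z
    by (simp add: F_def patch_def left_diff_distrib sum_subtractf)
  have derF: "(F c has_real_derivative G c x) (at x)" if c: "\<And>n. \<bar>c n\<bar> \<le> L" for c L x
    unfolding F_def G_def
  proof (rule DERIV_patch[OF dj])
    show "c n * (w n * \<phi> ((z - t n) / w n)) = 0" if "d n / 2 < \<bar>z - t n\<bar>" for n z
    proof -
      have "6 \<le> \<bar>(z - t n) / w n\<bar>"
        using that w[of n] by (simp add: abs_divide le_divide_eq)
      then show ?thesis by (simp add: supp)
    qed
    show "\<bar>c n * (w n * \<phi> ((z - t n) / w n))\<bar> \<le> L * (d n)^2" for n z
    proof -
      have "\<bar>c n\<bar> * (w n * \<bar>\<phi> ((z - t n) / w n)\<bar>) \<le> L * (w n * 12)"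
        using c[of n] w(1)[of n] \<phi>12 by (intro mult_mono) auto
      then show ?thesis using w(1)[of n] by (simp add: abs_mult) (simp add: w_def)
    qed
    show "((\<lambda>z. c n * (w n * \<phi> ((z - t n) / w n))) has_real_derivative
        c n * g ((z - t n) / w n)) (at z)" for n z
    proof -
      have "((\<lambda>z. \<phi> ((z - t n) / w n)) has_real_derivative g ((z - t n) / w n) * (1 / w n)) (at z)"
        by (rule DERIV_chain2[OF der]) (use w(1)[of n] in \<open>auto intro!: derivative_eq_intros\<close>)
      then have "((\<lambda>z. c n * (w n * \<phi> ((z - t n) / w n))) has_real_derivative
          c n * (w n * (g ((z - t n) / w n) * (1 / w n)))) (at z)"
        by (intro DERIV_cmult)
      then show ?thesis using w(1)[of n] by simp
    qed
  qed
  have F_lip: "\<bar>F c x - F c y\<bar> \<le> L * \<bar>x - y\<bar>" if c: "\<And>n. \<bar>c n\<bar> \<le> L" for c L x y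
  proof -
    have L: "0 \<le> L" using c[of 0] by linarith
    have "\<bar>G c z\<bar> \<le> L" for z
      unfolding G_def
    proof (rule patch_bound[OF dj L])
      show "\<bar>c n * g ((z - t n) / w n)\<bar> \<le> L" for n
        using mult_mono[OF c[of n] g1[of "(z - t n) / w n"]] L by (simp add: abs_mult)
    qed
    then have "norm (F c x - F c y) \<le> L * norm (x - y)"
      using derF[OF c] by (intro field_differentiable_bound[of UNIV "F c" "G c"]) auto
    then show ?thesis by simp
  qed

  \<comment> \<open>The space and its coordinate functionals\<close>
  define el where "el C c x = (if x \<in> I then C + F c x else 0)" for C c x
  \<comment> \<open>The constants \<open>C\<close> are forced: functions constant on
    \<open>I\<close> have seminorm 0, so every closed subspace contains them.\<close>
  define W where "W = {f. \<exists>C c. c \<longlonglongrightarrow> 0 \<and> f = el C c}"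
  \<comment> \<open>\<open>coef n\<close> reads off the coefficient of the \<open>n\<close>-th piece and is bounded for the Lipschitz seminorm
    uniformly in \<open>n\<close>, since all pieces are rescalings of \<open>\<phi>\<close>. This makes \<open>W\<close> closed.\<close>
  define coef where "coef n f = (f (t n + w n * \<alpha>) - f (t n - 6 * w n)) / (w n * \<phi> \<alpha>)"
    for n and f :: "real \<Rightarrow> real"
  \<comment> \<open>The two evaluation points of \<open>coef n\<close> are
    \<open>w n * (\<alpha> + 6)\<close> apart; dividing by \<open>w n * \<phi> \<alpha>\<close>
    cancels the scale, which makes \<kappa> independent of \<open>n\<close>.\<close>
  define \<kappa> where "\<kappa> = (\<bar>\<alpha>\<bar> + 6) / \<bar>\<phi> \<alpha>\<bar>"
  have \<kappa>: "0 < \<kappa>" using \<alpha> by (auto simp: \<kappa>_def)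
  have ends: "\<bar>(t n + w n * \<alpha>) - t n\<bar> < d n" "\<bar>(t n - 6 * w n) - t n\<bar> < d n" for n
  proof -
    have "\<bar>w n * \<alpha>\<bar> \<le> w n * 6"
      unfolding abs_mult using w(1)[of n] \<alpha>6 by (intro mult_mono) auto
    then show "\<bar>(t n + w n * \<alpha>) - t n\<bar> < d n" using w[of n] d[of n] by simp
    show "\<bar>(t n - 6 * w n) - t n\<bar> < d n" using w[of n] d[of n] by simp
  qed
  have coef_add: "coef n (f + f') = coef n f + coef n f'" for n f f'
    by (simp add: coef_def add_divide_distrib diff_divide_distrib)
  have coef_scale: "coef n (k *\<^sub>R f) = k * coef n f" for n k f
    by (simp add: coef_def right_diff_distrib)
  have coef_diff: "coef n (f - f') = coef n f - coef n f'" for n f f'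
    by (simp add: coef_def diff_divide_distrib)
  have coef_el: "coef n (el C c) = c n" for n C c
    using w(1)[of n] \<alpha> supp[of "-6"]
    by (simp add: coef_def el_def near[OF ends(1)] near[OF ends(2)] F_in[OF ends(1)] F_in[OF ends(2)])
  have coef_bound: "\<bar>coef n f\<bar> \<le> \<kappa> * Lip_norm I f" if f: "f \<in> Lip I" for n f
  proof -
    have "0 \<le> Lip_norm I f * \<bar>(x0 + \<delta>) - x0\<bar>"
      by (rule order_trans[OF _ Lip_norm_bound[OF f]]) (use ball[of "x0 + \<delta>"] x0 \<delta> in auto)
    then have nn: "0 \<le> Lip_norm I f" using \<delta> by (simp add: zero_le_mult_iff)
    have "\<bar>f (t n + w n * \<alpha>) - f (t n - 6 * w n)\<bar>
        \<le> Lip_norm I f * \<bar>(t n + w n * \<alpha>) - (t n - 6 * w n)\<bar>"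
      by (intro Lip_norm_bound f near[OF ends(1)] near[OF ends(2)])
    also have "(t n + w n * \<alpha>) - (t n - 6 * w n) = w n * (\<alpha> + 6)" by (simp add: algebra_simps)
    also have "Lip_norm I f * \<bar>w n * (\<alpha> + 6)\<bar> \<le> Lip_norm I f * (w n * (\<bar>\<alpha>\<bar> + 6))"
      unfolding abs_mult using nn w(1)[of n] by (intro mult_left_mono mult_mono) auto
    finally have "\<bar>f (t n + w n * \<alpha>) - f (t n - 6 * w n)\<bar>
        \<le> Lip_norm I f * (w n * (\<bar>\<alpha>\<bar> + 6))" .
    then have "\<bar>f (t n + w n * \<alpha>) - f (t n - 6 * w n)\<bar> / (w n * \<bar>\<phi> \<alpha>\<bar>)
        \<le> Lip_norm I f * (w n * (\<bar>\<alpha>\<bar> + 6)) / (w n * \<bar>\<phi> \<alpha>\<bar>)"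
      using w(1)[of n] by (intro divide_right_mono) auto
    then show ?thesis
      using w(1)[of n] by (simp add: coef_def \<kappa>_def abs_divide abs_mult mult.commute)
  qed
  have el_lip: "el C c \<in> Lip I" "Lip_norm I (el C c) \<le> L" if c: "\<And>n. \<bar>c n\<bar> \<le> L" for C c L
  proof -
    have *: "\<bar>el C c x - el C c y\<bar> \<le> L * \<bar>x - y\<bar>" if "x \<in> I" "y \<in> I" for x y
      using F_lip[OF c] that by (simp add: el_def)
    moreover have "0 \<le> L" using c[of 0] by linarith
    ultimately show "el C c \<in> Lip I" unfolding Lip_iff by (auto simp: el_def)
    show "Lip_norm I (el C c) \<le> L"
      using \<delta> by (intro Lip_norm_le[OF x0 ball[of "x0 + \<delta>"] _ *]) auto
  qed

  \<comment> \<open>Linear structure and dimension\<close>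
  have "subspace W"
    unfolding subspace_def
  proof (intro conjI ballI allI)
    have "0 = el 0 (\<lambda>_. 0)" by (auto simp: el_def F_def patch_def fun_eq_iff)
    then show "0 \<in> W" unfolding W_def by blast
  next
    fix f f' assume "f \<in> W" "f' \<in> W"
    then obtain C c C' c' where c: "c \<longlonglongrightarrow> 0" "f = el C c" "c' \<longlonglongrightarrow> 0" "f' = el C' c'"
      unfolding W_def by blast
    have "f + f' = el (C + C') (\<lambda>n. c n + c' n)"
      unfolding c by (auto simp: el_def F_add)
    moreover have "(\<lambda>n. c n + c' n) \<longlonglongrightarrow> 0" using tendsto_add[OF c(1,3)] by simp
    ultimately show "f + f' \<in> W" unfolding W_def by blast
  next
    fix k f assume "f \<in> W"
    then obtain C c where c: "c \<longlonglongrightarrow> 0" "f = el C c" unfolding W_def by blast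
    have "k *\<^sub>R f = el (k * C) (\<lambda>n. k * c n)"
      unfolding c by (auto simp: el_def F_scale distrib_left fun_eq_iff)
    moreover have "(\<lambda>n. k * c n) \<longlonglongrightarrow> 0" using tendsto_mult_left[OF c(1), of k] by simp
    ultimately show "k *\<^sub>R f \<in> W" unfolding W_def by blast
  qed

  moreover have "infinite_dimensional W"
  proof (rule infinite_dimensionalI[of "\<lambda>k. el 0 (\<lambda>n. if k = n then 1 else 0)" _ coef])
    show "range (\<lambda>k. el 0 (\<lambda>n. if k = n then 1 else 0)) \<subseteq> W"
    proof
      fix f assume "f \<in> range (\<lambda>k. el 0 (\<lambda>n. if k = n then 1 else 0))"
      then obtain k where "f = el 0 (\<lambda>n. if k = n then 1 else 0)" by blast
      moreover have "(\<lambda>n. if k = n then 1 else 0 :: real) \<longlonglongrightarrow> 0"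
        by (rule tendsto_eventually) (auto simp: eventually_sequentially intro: exI[of _ "Suc k"])
      ultimately show "f \<in> W" unfolding W_def by blast
    qed
  qed (simp_all add: coef_add coef_scale coef_el)

  \<comment> \<open>Differentiability and Clarke exhaustiveness\<close>
  moreover have "W \<subseteq> diff_clarke_exhaustive N I"
  proof
    fix f assume "f \<in> W"
    then obtain C c where c: "c \<longlonglongrightarrow> 0" and f: "f = el C c" unfolding W_def by blast
    obtain m where m: "\<And>n. \<bar>c n\<bar> \<le> \<bar>c m\<bar>" using null_sequence_attains_max[OF c] by blast
    have derf: "(f has_real_derivative G c x) (at x)" if "x \<in> I" for x
    proof (rule has_field_derivative_transform_within_open[OF _ I(1) that])
      show "((\<lambda>x. C + F c x) has_real_derivative G c x) (at x)"
        using DERIV_add[OF DERIV_const derF[OF m]] by simp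
    qed (simp add: f el_def)
    have "clarke_exhaustive N I f"
      unfolding clarke_exhaustive_def
    proof (intro allI impI, elim conjE)
      fix K assume K: "K \<noteq> {}" "closed K" "convex K" "K \<subseteq> {- Lip_norm I f .. Lip_norm I f}"
      then have "compact K" by (meson bounded_closed_interval bounded_subset compact_eq_bounded_closed)
      then obtain P Q where PQ: "K = {P..Q}"
        using K(3) connected_compact_interval_1 convex_connected by metis
      \<comment> \<open>This places \<open>K\<close> in [-|c m|, |c m|], the range that the piece
        with index \<open>m\<close> covers alone.\<close>
      have "Lip_norm I f \<le> \<bar>c m\<bar>" using el_lip(2)[OF m] f by simp
      then have PQ': "P \<le> Q" "- \<bar>c m\<bar> \<le> P" "Q \<le> \<bar>c m\<bar>" using K PQ by auto
      \<comment> \<open>Division by \<open>c m\<close> pulls the interval back into [-1, 1],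
        reversing it if \<open>c m\<close> is negative. If \<open>c m = 0\<close>, then
        \<open>K\<close> is {0}.\<close>
      obtain p q where pq: "-1 \<le> p" "p \<le> q" "q \<le> 1"
        "min (c m * p) (c m * q) = P" "max (c m * p) (c m * q) = Q"
      proof (cases "c m = 0")
        case True
        then show ?thesis using PQ' by (intro that[of 0 0]) auto
      next
        case False
        show ?thesis
        proof (cases "c m > 0")
          case True
          then show ?thesis using PQ'
            by (intro that[of "P / c m" "Q / c m"]) (auto simp: divide_simps)
        next
          case neg: False
          then show ?thesis using PQ' False
            by (intro that[of "Q / c m" "P / c m"]) (auto simp: divide_simps)
        qed
      qed
      obtain x where x: "\<bar>x\<bar> \<le> 1" "cluster_range g x p q" using range[OF pq(1-3)] by blast
      define X where "X = t m + w m * x"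
      have "\<bar>w m * x\<bar> \<le> w m * 1"
        unfolding abs_mult using w(1)[of m] x by (intro mult_mono) auto
      then have X: "\<bar>X - t m\<bar> < d m" using w[of m] d[of m] by (simp add: X_def)
      have "cluster_range (\<lambda>y. c m * g ((y - t m) / w m)) X P Q"
        using cluster_range_scale[OF cluster_range_affine[OF x(2) w(1)[of m], of "t m"], of "c m"] pq
        by (simp add: X_def)
      then have "cluster_range (G c) X P Q"
      proof (rule cluster_range_cong)
        show "open (ball (t m) (d m))" "X \<in> ball (t m) (d m)"
          using X by (auto simp: dist_real_def)
      qed (auto intro!: G_in simp: dist_real_def)
      then have "clarke_subdiff N I f X = {P..Q}"
        using I(1) near[OF X] derf N by (intro clarke_subdiff_eq_cluster_range[where g = "G c"])
      then show "\<exists>x\<in>I. clarke_subdiff N I f x = K" using near[OF X] PQ by blast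
    qed
    then show "f \<in> diff_clarke_exhaustive N I"
      using derf el_lip(1)[OF m] f
      by (auto simp: diff_clarke_exhaustive_def real_differentiable_def)
  qed

  \<comment> \<open>Closedness\<close>
  moreover have WL: "W \<subseteq> Lip I"
    using null_sequence_attains_max el_lip(1) unfolding W_def by blast
  have "closedin (semidist_topology (Lip I) (Lip_dist I)) W"
  proof -
    have "f \<in> W" if f: "f \<in> Lip I" and lim: "\<And>r. r > 0 \<Longrightarrow> \<exists>h\<in>W. Lip_dist I f h < r" for f
    proof -
      \<comment> \<open>An element of \<open>W\<close> within distance \<open>r\<close> of
        \<open>f\<close> has coefficients within \<open>\<kappa> * r\<close> of those of
        \<open>f\<close>, uniformly in \<open>n\<close>. So the coefficient sequence of
        \<open>f\<close> is a uniform limit of null sequences.\<close>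
      have approx: "\<exists>C c. c \<longlonglongrightarrow> 0 \<and> (\<forall>n. \<bar>coef n f - c n\<bar> \<le> \<kappa> * r) \<and>
          (\<forall>x\<in>I. \<forall>y\<in>I. \<bar>(f - el C c) x - (f - el C c) y\<bar> \<le> r * \<bar>x - y\<bar>)" if r0: "r > 0" for r
      proof -
        obtain h where h: "h \<in> W" "Lip_dist I f h < r" using lim[OF r0] by blast
        then obtain C c where c: "c \<longlonglongrightarrow> 0" "h = el C c" unfolding W_def by blast
        have L: "f - h \<in> Lip I" using f WL h by (intro Lip_diff) auto
        have r: "Lip_norm I (f - h) \<le> r" using h(2) by (simp add: Lip_dist_def)
        have "\<bar>coef n f - c n\<bar> \<le> \<kappa> * r" for n
          using order_trans[OF coef_bound[OF L, of n] mult_left_mono[OF r, of \<kappa>]] \<kappa>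
          by (simp add: coef_diff c coef_el)
        moreover have "\<bar>(f - h) x - (f - h) y\<bar> \<le> r * \<bar>x - y\<bar>" if "x \<in> I" "y \<in> I" for x y
          using Lip_norm_bound[OF L that] mult_right_mono[OF r, of "\<bar>x - y\<bar>"] by linarith
        ultimately show ?thesis using c by blast
      qed
      define c where "c n = coef n f" for n
      have "c \<longlonglongrightarrow> 0"
      proof (rule LIMSEQ_I)
        fix e :: real assume e: "e > 0"
        then obtain C c' where c': "c' \<longlonglongrightarrow> 0" "\<And>n. \<bar>c n - c' n\<bar> \<le> \<kappa> * (e / (2 * \<kappa>))"
          using approx[of "e / (2 * \<kappa>)"] \<kappa> unfolding c_def by auto
        obtain n0 where "\<And>n. n \<ge> n0 \<Longrightarrow> \<bar>c' n\<bar> < e / 2"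
          using LIMSEQ_D[OF c'(1), of "e / 2"] e by auto
        moreover have "\<bar>c n - c' n\<bar> \<le> e / 2" for n using c'(2)[of n] \<kappa> by simp
        ultimately have "\<forall>n\<ge>n0. norm (c n - 0) < e" by (smt (verit) diff_zero real_norm_def field_sum_of_halves)
        then show "\<exists>n0. \<forall>n\<ge>n0. norm (c n - 0) < e" by blast
      qed
      \<comment> \<open>Evaluation at \<open>x0\<close> dictates the constant; it remains to see
        that \<open>f - F c\<close> takes the same value at every \<open>x\<close> in
        \<open>I\<close>.\<close>
      moreover have "f = el (f x0 - F c x0) c"
      proof
        fix x
        show "f x = el (f x0 - F c x0) c x"
        proof (cases "x \<in> I")
          case True
          let ?D = "\<bar>(f x - F c x) - (f x0 - F c x0)\<bar>"
          have "?D \<le> 0 + e" if e: "e > 0" for e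
          proof -
            \<comment> \<open>The approximant contributes an error
              \<open>r * \<bar>x - x0\<bar>\<close> and the change of coefficients another
              \<open>\<kappa> * r * \<bar>x - x0\<bar>\<close>; \<open>r\<close> makes the total at
              most \<open>e\<close>, and the added 1 avoids division by zero at
              \<open>x = x0\<close>.\<close>
            define r where "r = e / ((1 + \<kappa>) * (\<bar>x - x0\<bar> + 1))"
            have pos: "0 < (1 + \<kappa>) * (\<bar>x - x0\<bar> + 1)" using \<kappa> by (intro mult_pos_pos) auto
            have ne: "1 + \<kappa> \<noteq> 0" using \<kappa> by simp
            have r: "r > 0" using e pos by (simp add: r_def)
            obtain C c' where c': "\<And>n. \<bar>c n - c' n\<bar> \<le> \<kappa> * r"
              "\<bar>(f - el C c') x - (f - el C c') x0\<bar> \<le> r * \<bar>x - x0\<bar>"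
              using approx[OF r] True x0 unfolding c_def by blast
            have "\<bar>F (\<lambda>n. c n - c' n) x - F (\<lambda>n. c n - c' n) x0\<bar> \<le> \<kappa> * r * \<bar>x - x0\<bar>"
              by (rule F_lip) (rule c')
            then have "?D \<le> r * \<bar>x - x0\<bar> + \<kappa> * r * \<bar>x - x0\<bar>"
              using c'(2) True x0 by (simp add: F_diff el_def)
            also have "\<dots> \<le> r * ((1 + \<kappa>) * (\<bar>x - x0\<bar> + 1))"
              using r \<kappa> by (simp add: algebra_simps)
            also have "\<dots> = e" using pos ne by (simp add: r_def)
            finally show ?thesis by simp
          qed
          then have "?D \<le> 0" by (rule field_le_epsilon)
          then show ?thesis using True by (simp add: el_def)
        next
          case False
          then show ?thesis using f by (simp add: el_def Lip_iff)
        qed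
      qed
      ultimately show ?thesis unfolding W_def by blast
    qed
    then show ?thesis
      using WL unfolding closedin_def openin_semidist_topology topspace_semidist_topology by blast
  qed
  ultimately show ?thesis unfolding spaceable_def by blast
qed

theorem mainTheorem5:
  fixes a b :: ereal and N :: "real set"
  assumes "a < b"
    and "N \<in> null_sets lebesgue"
  shows "spaceable (Lip (einterval a b)) (Lip_dist (einterval a b))
           (diff_clarke_exhaustive N (einterval a b))"
proof (rule profile_exists)
  fix \<phi> g :: "real \<Rightarrow> real"
  assume \<phi>: "\<And>x. (\<phi> has_real_derivative g x) (at x)" "\<And>x. \<bar>g x\<bar> \<le> 1"
    "\<And>x. 6 \<le> \<bar>x\<bar> \<Longrightarrow> \<phi> x = 0"
    "\<And>p q. -1 \<le> p \<Longrightarrow> p \<le> q \<Longrightarrow> q \<le> 1 \<Longrightarrow> \<exists>x. \<bar>x\<bar> \<le> 1 \<and> cluster_range g x p q"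
  show ?thesis
  proof (rule spaceable_diff_clarke_exhaustive_of_profile[OF _ _ assms(2) \<phi>])
    show "einterval a b \<noteq> {}"
      using einterval_nonempty[OF assms(1)] by (auto simp: einterval_def)
  qed (rule open_einterval)
qed

end
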